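(* Let $M$ be a quasi-biharmonic marginally trapped Lagrangian surface in $\mathbf{C}_1^2$. Then $M$ is locally congruent to $$\phi(x,y)=e^{i\mu y}z(x),$$ where $\mu$ is a nonzero real number and $z(x)$ is a null curve in the light cone $\mathcal{L}C\subset\mathbf{C}_1^2$ satisfying $$\langle z, iz'\rangle=\mu^{-1},\qquad z''\neq 0$$ at each point on $M$.
   Context: $\mathbf{C}_1^2$ is the flat Lorentzian complex plane: $\mathbf{C}^2$ with complex coordinates $z_1,z_2$, its standard complex structure $J$ (multiplication by $i$) and the metric $\langle z,w\rangle=\mathrm{Re}(-z_1\bar w_1+z_2\bar w_2)$. A vector $X$ is lightlike if $X\neq 0$ and $\langle X,X\rangle=0$. The light cone is $\mathcal{L}C=\{z:\langle z,z\rangle=0\}$. A curve $z(t)$ is null if $z'(t)$ is lightlike for every $t$. A Lagrangian surface $M$ in $\mathbf{C}_1^2$ is a (real) 2-dimensional pseudo-Riemannian manifold isometrically immersed so that $J$ interchanges the tangent and normal spaces of $M$. Its mean curvature vector field is $H=\frac12\mathrm{tr}\,h$, where $h$ is the second fundamental form. $M$ is marginally trapped if $H$ is lightlike at each point. For an isometric immersion $\phi:M\to N$ of an $m$-dimensional pseudo-Riemannian manifold into a pseudo-Riemannian manifold, with Levi-Civita connection $\nabla$ of $M$, induced connection $\nabla^\phi$ on $\phi^*TN$, local orthonormal frame $\{e_i\}$ of $M$, and curvature tensor $R^N$ of $N$ (convention $R(X,Y)=[\nabla_X,\nabla_Y]-\nabla_{[X,Y]}$), the tension field is $\tau=\tau(\phi)=\sum_{i=1}^m\langle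 e_i,e_i\rangle\{\nabla^\phi_{e_i}d\phi(e_i)-d\phi(\nabla_{e_i}e_i)\}=mH$ and the bitension field is $$\tau_2(\phi)=\sum_{i=1}^{m}\langle e_i,e_i\rangle\{(\nabla^{\phi}_{e_i}\nabla^{\phi}_{e_i}-\nabla^{\phi}_{\nabla_{e_i}e_i})\tau+R^{N}(\tau,d\phi(e_i))d\phi(e_i)\}.$$ The submanifold $M$ is quasi-biharmonic if $\tau_2(\phi)$ is lightlike at each point of $M$. *)

theory Defs
  imports "HOL-Analysis.Analysis"
begin

definition lorentz :: "complex^2 \<Rightarrow> complex^2 \<Rightarrow> real" where
  "lorentz z w = Re (- (z$1) * cnj (w$1) + (z$2) * cnj (w$2))"

definition J :: "complex^2 \<Rightarrow> complex^2" where
  "J z = \<i> *s z"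

definition lightlike :: "complex^2 \<Rightarrow> bool" where
  "lightlike X \<longleftrightarrow> X \<noteq> 0 \<and> lorentz X X = 0"

definition light_cone :: "(complex^2) set" where
  "light_cone = {z. lorentz z z = 0}"

text \<open>Congruence is understood with respect to the rigid motions of the complex plane with its
  metric and its complex structure, i.e. the group generated by the complex-linear isometries
  and the translations.\<close>

definition rigid_motion :: "(complex^2 \<Rightarrow> complex^2) \<Rightarrow> bool" where
  "rigid_motion \<Phi> \<longleftrightarrow>
     (\<exists>(A :: complex^2^2) b. (\<forall>v w. lorentz (A *v v) (A *v w) = lorentz v w) \<and>
        \<Phi> = (\<lambda>w. A *v w + b))"

text \<open>The notions below are meant for open sets \<open>S\<close>.\<close>

fun Ck_on :: "nat \<Rightarrow> ('a::real_normed_vector \<Rightarrow> 'b::real_normed_vector) \<Rightarrow> 'a set \<Rightarrow> bool" where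
  "Ck_on 0 f S \<longleftrightarrow> continuous_on S f"
| "Ck_on (Suc k) f S \<longleftrightarrow>
     (\<forall>x\<in>S. f differentiable (at x)) \<and> (\<forall>v. Ck_on k (\<lambda>x. frechet_derivative f (at x) v) S)"

definition smooth_on :: "('a::real_normed_vector \<Rightarrow> 'b::real_normed_vector) \<Rightarrow> 'a set \<Rightarrow> bool" where
  "smooth_on f S \<longleftrightarrow> (\<forall>k. Ck_on k f S)"

type_synonym 'a chart = "'a set \<times> ('a \<Rightarrow> real^2)"

definition is_chart :: "'a topology \<Rightarrow> 'a chart \<Rightarrow> bool" where
  "is_chart X = (\<lambda>(U, c). openin X U \<and> open (c ` U) \<and>
     homeomorphic_map (subtopology X U) (top_of_set (c ` U)) c)"

definition compatible :: "'a chart \<Rightarrow> 'a chart \<Rightarrow> bool" where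
  "compatible = (\<lambda>(U, c) (V, d).
     smooth_on (d \<circ> inv_into U c) (c ` (U \<inter> V)) \<and>
     smooth_on (c \<circ> inv_into V d) (d ` (U \<inter> V)))"

definition smooth_surface :: "'a topology \<Rightarrow> 'a chart set \<Rightarrow> bool" where
  "smooth_surface X \<A> \<longleftrightarrow>
     Hausdorff_space X \<and> second_countable X \<and>
     (\<forall>\<kappa>\<in>\<A>. is_chart X \<kappa>) \<and> (\<Union>\<kappa>\<in>\<A>. fst \<kappa>) = topspace X \<and>
     (\<forall>\<kappa>\<in>\<A>. \<forall>\<kappa>'\<in>\<A>. compatible \<kappa> \<kappa>')"

text \<open>The charts of the maximal atlas generated by \<open>\<A>\<close>.\<close>

definition smooth_chart :: "'a topology \<Rightarrow> 'a chart set \<Rightarrow> 'a chart \<Rightarrow> bool" where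
  "smooth_chart X \<A> \<kappa> \<longleftrightarrow> is_chart X \<kappa> \<and> (\<forall>\<kappa>'\<in>\<A>. compatible \<kappa> \<kappa>')"

definition local_rep :: "('a \<Rightarrow> complex^2) \<Rightarrow> 'a chart \<Rightarrow> real^2 \<Rightarrow> complex^2" where
  "local_rep F \<kappa> = F \<circ> inv_into (fst \<kappa>) (snd \<kappa>)"

definition chart_image :: "'a chart \<Rightarrow> (real^2) set" where
  "chart_image \<kappa> = snd \<kappa> ` fst \<kappa>"

text \<open>Here \<open>f\<close> is the expression of an immersion in a chart, tangent vectors are identified with
  elements of \<open>real^2\<close>, and vector fields and sections of the pulled-back tangent bundle
  with functions on (an open subset of) the image of the chart.\<close>

abbreviation differential :: "(real^2 \<Rightarrow> 'b::real_normed_vector) \<Rightarrow> real^2 \<Rightarrow> real^2 \<Rightarrow> 'b" where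
  "differential f u \<equiv> frechet_derivative f (at u)"

definition induced_metric :: "(real^2 \<Rightarrow> complex^2) \<Rightarrow> real^2 \<Rightarrow> real^2 \<Rightarrow> real^2 \<Rightarrow> real" where
  "induced_metric f u v w = lorentz (differential f u v) (differential f u w)"

definition nondegenerate :: "(real^2 \<Rightarrow> complex^2) \<Rightarrow> real^2 \<Rightarrow> bool" where
  "nondegenerate f u \<longleftrightarrow> (\<forall>v. (\<forall>w. induced_metric f u v w = 0) \<longrightarrow> v = 0)"

definition tangent_space :: "(real^2 \<Rightarrow> complex^2) \<Rightarrow> real^2 \<Rightarrow> (complex^2) set" where
  "tangent_space f u = range (differential f u)"

definition normal_space :: "(real^2 \<Rightarrow> complex^2) \<Rightarrow> real^2 \<Rightarrow> (complex^2) set" where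
  "normal_space f u = {w. \<forall>v\<in>tangent_space f u. lorentz v w = 0}"

definition gram :: "(real^2 \<Rightarrow> complex^2) \<Rightarrow> real^2 \<Rightarrow> real^2^2" where
  "gram f u = (\<chi> i j. induced_metric f u (axis i 1) (axis j 1))"

definition christoffel :: "(real^2 \<Rightarrow> complex^2) \<Rightarrow> real^2 \<Rightarrow> 2 \<Rightarrow> 2 \<Rightarrow> 2 \<Rightarrow> real" where
  "christoffel f u k i j =
     (\<Sum>l\<in>UNIV. matrix_inv (gram f u) $ k $ l *
        (differential (\<lambda>u. gram f u $ j $ l) u (axis i 1)
         + differential (\<lambda>u. gram f u $ i $ l) u (axis j 1)
         - differential (\<lambda>u. gram f u $ i $ j) u (axis l 1))) / 2"

definition levi_civita ::
    "(real^2 \<Rightarrow> complex^2) \<Rightarrow> (real^2 \<Rightarrow> real^2) \<Rightarrow> (real^2 \<Rightarrow> real^2) \<Rightarrow> real^2 \<Rightarrow> real^2" where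
  "levi_civita f X Y u = differential Y u (X u)
     + (\<chi> k. \<Sum>i\<in>UNIV. \<Sum>j\<in>UNIV. christoffel f u k i j * X u $ i * Y u $ j)"

text \<open>The ambient space is flat, so the connection induced on the pulled-back tangent bundle is
  the componentwise derivative of sections.\<close>

definition pullback_conn ::
    "(real^2 \<Rightarrow> real^2) \<Rightarrow> (real^2 \<Rightarrow> complex^2) \<Rightarrow> real^2 \<Rightarrow> complex^2" where
  "pullback_conn X s u = differential s u (X u)"

definition push :: "(real^2 \<Rightarrow> complex^2) \<Rightarrow> (real^2 \<Rightarrow> real^2) \<Rightarrow> real^2 \<Rightarrow> complex^2" where
  "push f X u = differential f u (X u)"

definition second_fundamental_form ::
    "(real^2 \<Rightarrow> complex^2) \<Rightarrow> (real^2 \<Rightarrow> real^2) \<Rightarrow> (real^2 \<Rightarrow> real^2) \<Rightarrow> real^2 \<Rightarrow> complex^2" where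
  "second_fundamental_form f X Y u =
     pullback_conn X (push f Y) u - push f (levi_civita f X Y) u"

definition orthonormal_frame ::
    "(real^2 \<Rightarrow> complex^2) \<Rightarrow> (real^2) set \<Rightarrow> (2 \<Rightarrow> real^2 \<Rightarrow> real^2) \<Rightarrow> bool" where
  "orthonormal_frame f V e \<longleftrightarrow>
     (\<forall>i. smooth_on (e i) V) \<and>
     (\<forall>u\<in>V. \<forall>i j. if i = j then \<bar>induced_metric f u (e i u) (e j u)\<bar> = 1
                  else induced_metric f u (e i u) (e j u) = 0)"

text \<open>For an orthonormal frame \<open>e\<close> near \<open>u\<close>, the values at \<open>u\<close> of the following three fields do
  not depend on the choice of \<open>e\<close>.\<close>

definition mean_curvature ::
    "(real^2 \<Rightarrow> complex^2) \<Rightarrow> (2 \<Rightarrow> real^2 \<Rightarrow> real^2) \<Rightarrow> real^2 \<Rightarrow> complex^2" where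
  "mean_curvature f e u = (1/2) *\<^sub>R
     (\<Sum>i\<in>UNIV. induced_metric f u (e i u) (e i u) *\<^sub>R second_fundamental_form f (e i) (e i) u)"

definition tension ::
    "(real^2 \<Rightarrow> complex^2) \<Rightarrow> (2 \<Rightarrow> real^2 \<Rightarrow> real^2) \<Rightarrow> real^2 \<Rightarrow> complex^2" where
  "tension f e u =
     (\<Sum>i\<in>UNIV. induced_metric f u (e i u) (e i u) *\<^sub>R
        (pullback_conn (e i) (push f (e i)) u - push f (levi_civita f (e i) (e i)) u))"

text \<open>The curvature tensor of the ambient flat connection; by tensoriality it can be evaluated on
  constant extensions of the three vectors, whose Lie bracket is zero. (It vanishes.)\<close>

definition ambient_conn ::
    "(complex^2 \<Rightarrow> complex^2) \<Rightarrow> (complex^2 \<Rightarrow> complex^2) \<Rightarrow> complex^2 \<Rightarrow> complex^2" where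
  "ambient_conn X Y p = frechet_derivative Y (at p) (X p)"

definition ambient_curvature ::
    "complex^2 \<Rightarrow> complex^2 \<Rightarrow> complex^2 \<Rightarrow> complex^2 \<Rightarrow> complex^2" where
  "ambient_curvature p a b c =
     ambient_conn (\<lambda>_. a) (ambient_conn (\<lambda>_. b) (\<lambda>_. c)) p
     - ambient_conn (\<lambda>_. b) (ambient_conn (\<lambda>_. a) (\<lambda>_. c)) p"

definition bitension ::
    "(real^2 \<Rightarrow> complex^2) \<Rightarrow> (2 \<Rightarrow> real^2 \<Rightarrow> real^2) \<Rightarrow> real^2 \<Rightarrow> complex^2" where
  "bitension f e u =
     (\<Sum>i\<in>UNIV. induced_metric f u (e i u) (e i u) *\<^sub>R
        (pullback_conn (e i) (pullback_conn (e i) (tension f e)) u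
         - pullback_conn (levi_civita f (e i) (e i)) (tension f e) u
         + ambient_curvature (f u) (tension f e u) (push f (e i) u) (push f (e i) u)))"

text \<open>The metric of the surface is the one making the immersion \<open>F\<close> isometric, i.e. the induced
  one; to be pseudo-Riemannian it has to be nondegenerate.\<close>

definition lagrangian_surface :: "'a topology \<Rightarrow> 'a chart set \<Rightarrow> ('a \<Rightarrow> complex^2) \<Rightarrow> bool" where
  "lagrangian_surface X \<A> F \<longleftrightarrow> smooth_surface X \<A> \<and>
     (\<forall>\<kappa>\<in>\<A>. let f = local_rep F \<kappa> in smooth_on f (chart_image \<kappa>) \<and>
        (\<forall>u\<in>chart_image \<kappa>.
           inj (differential f u) \<and> nondegenerate f u \<and>
           J ` tangent_space f u = normal_space f u \<and>
           J ` normal_space f u = tangent_space f u))"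

text \<open>Locally on a chart image, smooth orthonormal frames for a nondegenerate metric always
  exist, so the quantifications over all local frames below are not vacuous.\<close>

definition marginally_trapped :: "'a chart set \<Rightarrow> ('a \<Rightarrow> complex^2) \<Rightarrow> bool" where
  "marginally_trapped \<A> F \<longleftrightarrow>
     (\<forall>\<kappa>\<in>\<A>. \<forall>V e. open V \<longrightarrow> V \<subseteq> chart_image \<kappa> \<longrightarrow> orthonormal_frame (local_rep F \<kappa>) V e \<longrightarrow>
        (\<forall>u\<in>V. lightlike (mean_curvature (local_rep F \<kappa>) e u)))"

definition quasi_biharmonic :: "'a chart set \<Rightarrow> ('a \<Rightarrow> complex^2) \<Rightarrow> bool" where
  "quasi_biharmonic \<A> F \<longleftrightarrow>
     (\<forall>\<kappa>\<in>\<A>. \<forall>V e. open V \<longrightarrow> V \<subseteq> chart_image \<kappa> \<longrightarrow> orthonormal_frame (local_rep F \<kappa>) V e \<longrightarrow>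
        (\<forall>u\<in>V. lightlike (bitension (local_rep F \<kappa>) e u)))"

abbreviation velocity :: "(real \<Rightarrow> complex^2) \<Rightarrow> real \<Rightarrow> complex^2" where
  "velocity z t \<equiv> vector_derivative z (at t)"

abbreviation acceleration :: "(real \<Rightarrow> complex^2) \<Rightarrow> real \<Rightarrow> complex^2" where
  "acceleration z t \<equiv> vector_derivative (velocity z) (at t)"

definition null_curve :: "(real \<Rightarrow> complex^2) \<Rightarrow> real set \<Rightarrow> bool" where
  "null_curve z I \<longleftrightarrow> smooth_on z I \<and> (\<forall>t\<in>I. lightlike (velocity z t))"

end

theory Submission
  imports Defs
begin

text \<open>Near a point of a chart, let \<open>f\<close> be the immersion. Everything is read off from one null frame. As the
surface is Lagrangian, \<open>J\<close> times the mean curvature vector \<open>H\<close> is tangent, and it is null; take \<open>e1 = J H\<close> and let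
\<open>e2\<close> be the null tangent vector with \<open>\<langle>e1, e2\<rangle> = - 1\<close>. A tangent null pair spans \<open>\<complex>\<^sup>2\<close> over \<open>\<complex>\<close>, and the
metric, the symmetry of the cubic form \<open>\<langle>h(X, Y), J Z\<rangle>\<close> and \<open>H = - h(e1, e2)\<close> leave only four real unknown functions
(lemma \<open>structure_equations\<close>):
  \<open>D1 e1 = w1 e1 + k1 J e2\<close>, \<open>D1 e2 = J e1 - w1 e2\<close>, \<open>D2 e1 = w2 e1 + J e1\<close>, \<open>D2 e2 = k2 J e1 + J e2 - w2 e2\<close>.

The ambient connection is flat, so \<open>D1 D2 - D2 D1\<close> is the derivative along the bracket of the frame. Applied to
\<open>e1\<close> and \<open>e2\<close> this gives \<open>w1 = 0\<close>, \<open>D1 w2 = - k1 k2\<close> and \<open>D1 k2 = w2\<close>. Since \<open>w1 = 0\<close>, the covariant derivative of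
\<open>e2\<close> along \<open>e1\<close> vanishes, so the bitension field, being the rough Laplacian of the tension field
\<open>- 2 J e1\<close>, is just \<open>4 J D1 D2 e1\<close>. Its square norm is \<open>- 32 k1\<^sup>2 k2\<close>, and the field itself is zero wherever \<open>k1\<close> is. Being
lightlike therefore means \<open>k1 \<noteq> 0\<close> and \<open>k2 = 0\<close>, hence \<open>w2 = D1 k2 = 0\<close>: the surface is flat, with parallel frame
(lemma \<open>lightlike_imp_flat\<close>).

Now \<open>D2 e2 = J e2\<close>, \<open>D1 e2 = J e1\<close> and \<open>D2 e1 = J e1\<close> integrate at sight. The dual coframe is closed, so by
the Poincare lemma and the inverse function theorem there are coordinates \<open>x, y\<close> with coordinate fields
\<open>e1, e2\<close>. The map \<open>f + J e2\<close> is a constant \<open>c\<close>, and \<open>f - c = - J e2\<close> is multiplied by \<open>J\<close> under the derivative along \<open>y\<close>,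
so \<open>f = e\<^sup>i\<^sup>y z(x) + c\<close> with the properties of \<open>z\<close> inherited from the frame (lemma \<open>local_normal_form\<close>). The scaling
\<open>e1 = J H\<close> of the null pair normalises \<open>\<mu>\<close> to \<open>1\<close>.

The supporting material is calculus for the class of smooth maps at hand (closure properties, symmetry of second
derivatives, the Poincare lemma on balls), the identification of the Christoffel term with the tangential projection, and
the existence of smooth orthonormal frames, through which the mean curvature and the bitension field are defined.\<close>

section \<open>Calculus of smooth maps\<close>

lemma has_frechet_derivative:
  "f differentiable (at x) \<Longrightarrow> (f has_derivative frechet_derivative f (at x)) (at x)"
  using frechet_derivative_works by blast

lemma frechet_derivative_eq:
  "(f has_derivative f') (at x) \<Longrightarrow> frechet_derivative f (at x) = f'"
  by (rule frechet_derivative_at [symmetric])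

lemma frechet_derivative_cong_open:
  assumes "open S" "x \<in> S" "\<And>y. y \<in> S \<Longrightarrow> f y = g y"
  shows "frechet_derivative f (at x) = frechet_derivative g (at x)"
proof -
  have "(f has_derivative f') (at x) \<longleftrightarrow> (g has_derivative f') (at x)" for f'
    using has_derivative_transform_within_open[of f f' x UNIV S g]
      has_derivative_transform_within_open[of g f' x UNIV S f] assms by auto
  then show ?thesis
    unfolding frechet_derivative_def by simp
qed

lemma differentiable_cong_open:
  assumes "open S" "x \<in> S" "\<And>y. y \<in> S \<Longrightarrow> f y = g y" "f differentiable (at x)"
  shows "g differentiable (at x)"
  using assms has_derivative_transform_within_open[of f _ x UNIV S g]
  unfolding differentiable_def by auto

lemma Ck_on_cong:
  assumes "open S" "\<And>x. x \<in> S \<Longrightarrow> f x = g x" "Ck_on k f S"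
  shows "Ck_on k g S"
  using assms(2,3)
proof (induction k arbitrary: f g)
  case 0
  then show ?case by (simp cong: continuous_on_cong)
next
  case (Suc k)
  have "Ck_on k (\<lambda>x. frechet_derivative g (at x) v) S" for v
  proof (rule Suc.IH)
    show "frechet_derivative f (at x) v = frechet_derivative g (at x) v" if "x \<in> S" for x
      using frechet_derivative_cong_open[OF assms(1) that, of f g] Suc.prems(1) by simp
    show "Ck_on k (\<lambda>x. frechet_derivative f (at x) v) S"
      using Suc.prems(2) by simp
  qed
  then show ?case
    using Suc.prems differentiable_cong_open[OF assms(1), of _ f g] by auto
qed

lemma Ck_on_imp_continuous_on: "Ck_on k f S \<Longrightarrow> continuous_on S f"
  by (cases k)
    (auto intro!: continuous_at_imp_continuous_on differentiable_imp_continuous_within)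

lemma Ck_on_SucD: "Ck_on (Suc k) f S \<Longrightarrow> Ck_on k f S"
proof (induction k arbitrary: f)
  case 0
  then show ?case using Ck_on_imp_continuous_on by (metis Ck_on.simps(1))
next
  case (Suc k)
  then show ?case by (metis Ck_on.simps(2))
qed

lemma Ck_on_subset: "Ck_on k f S \<Longrightarrow> T \<subseteq> S \<Longrightarrow> Ck_on k f T"
proof (induction k arbitrary: f)
  case 0
  then show ?case using continuous_on_subset by auto
next
  case (Suc k)
  then show ?case by (auto simp: subset_iff)
qed

lemma Ck_on_SucI:
  assumes "open S" "\<And>x. x \<in> S \<Longrightarrow> (f has_derivative f' x) (at x)" "\<And>v. Ck_on k (\<lambda>x. f' x v) S"
  shows "Ck_on (Suc k) f S"
proof -
  have "Ck_on k (\<lambda>x. frechet_derivative f (at x) v) S" for v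
    using Ck_on_cong[OF assms(1) _ assms(3)] frechet_derivative_eq[OF assms(2)] by simp
  then show ?thesis
    using assms(2) by (auto simp: differentiable_def)
qed

lemma Ck_on_const [simp]: "Ck_on k (\<lambda>x. c) S"
  by (induction k arbitrary: c) auto

lemma Ck_on_bounded_linear:
  assumes "bounded_linear L" "open S" "Ck_on k f S"
  shows "Ck_on k (\<lambda>x. L (f x)) S"
  using assms(3)
proof (induction k arbitrary: f)
  case 0
  then show ?case using assms(1) by (simp add: bounded_linear.continuous_on)
next
  case (Suc k)
  show ?case
  proof (rule Ck_on_SucI[OF assms(2)])
    show "((\<lambda>x. L (f x)) has_derivative (\<lambda>v. L (frechet_derivative f (at x) v))) (at x)"
      if "x \<in> S" for x
      using Suc.prems that
      by (intro bounded_linear.has_derivative[OF assms(1)] has_frechet_derivative) auto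
    show "Ck_on k (\<lambda>x. L (frechet_derivative f (at x) v)) S" for v
      using Suc by simp
  qed
qed

lemma Ck_on_add:
  assumes "open S" "Ck_on k f S" "Ck_on k g S"
  shows "Ck_on k (\<lambda>x. f x + g x) S"
  using assms(2,3)
proof (induction k arbitrary: f g)
  case 0
  then show ?case by (simp add: continuous_on_add)
next
  case (Suc k)
  show ?case
  proof (rule Ck_on_SucI[OF assms(1)])
    show "((\<lambda>x. f x + g x) has_derivative
        (\<lambda>v. frechet_derivative f (at x) v + frechet_derivative g (at x) v)) (at x)"
      if "x \<in> S" for x
      using Suc.prems that by (intro has_derivative_add has_frechet_derivative) auto
    show "Ck_on k (\<lambda>x. frechet_derivative f (at x) v + frechet_derivative g (at x) v) S" for v
      using Suc by simp
  qed
qed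

lemma Ck_on_bounded_bilinear:
  assumes "bounded_bilinear B" "open S" "Ck_on k f S" "Ck_on k g S"
  shows "Ck_on k (\<lambda>x. B (f x) (g x)) S"
  using assms(3,4)
proof (induction k arbitrary: f g)
  case 0
  then show ?case using assms(1) by (simp add: bounded_bilinear.continuous_on)
next
  case (Suc k)
  show ?case
  proof (rule Ck_on_SucI[OF assms(2)])
    show "((\<lambda>x. B (f x) (g x)) has_derivative
        (\<lambda>v. B (f x) (frechet_derivative g (at x) v) + B (frechet_derivative f (at x) v) (g x))) (at x)"
      if "x \<in> S" for x
      using Suc.prems that
      by (intro bounded_bilinear.FDERIV[OF assms(1)] has_frechet_derivative) auto
    show "Ck_on k (\<lambda>x. B (f x) (frechet_derivative g (at x) v) + B (frechet_derivative f (at x) v) (g x)) S"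
      for v
    proof -
      have "Ck_on k f S" "Ck_on k g S"
        using Suc.prems by (auto intro: Ck_on_SucD simp del: Ck_on.simps)
      moreover have "Ck_on k (\<lambda>x. frechet_derivative f (at x) v) S" "Ck_on k (\<lambda>x. frechet_derivative g (at x) v) S"
        using Suc.prems by auto
      ultimately show ?thesis
        by (intro Ck_on_add[OF assms(2)] Suc.IH)
    qed
  qed
qed

lemma Ck_on_sum:
  assumes "open S" "\<And>i. i \<in> I \<Longrightarrow> Ck_on k (f i) S"
  shows "Ck_on k (\<lambda>x. \<Sum>i\<in>I. f i x) S"
  using assms(2) by (induction I rule: infinite_finite_induct) (auto intro: Ck_on_add[OF assms(1)])

lemma linear_basis_expansion:
  fixes L :: "'a::euclidean_space \<Rightarrow> 'b::real_vector"
  assumes "linear L"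
  shows "L v = (\<Sum>b\<in>Basis. (v \<bullet> b) *\<^sub>R L b)"
proof -
  have "L v = L (\<Sum>b\<in>Basis. (v \<bullet> b) *\<^sub>R b)"
    by (simp add: euclidean_representation)
  also have "\<dots> = (\<Sum>b\<in>Basis. L ((v \<bullet> b) *\<^sub>R b))"
    by (rule linear_sum[OF assms])
  finally show ?thesis
    by (simp only: linear_cmul[OF assms])
qed

lemma frechet_derivative_basis_expansion:
  fixes f :: "'a::euclidean_space \<Rightarrow> 'b::real_normed_vector"
  assumes "f differentiable (at x)"
  shows "frechet_derivative f (at x) v = (\<Sum>b\<in>Basis. (v \<bullet> b) *\<^sub>R frechet_derivative f (at x) b)"
  by (rule linear_basis_expansion) (rule linear_frechet_derivative[OF assms])

text \<open>Differentiating along a variable direction costs nothing: the direction is expanded in the standard basis,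
which reduces to the constant directions of the inductive definition.\<close>

lemma Ck_on_frechet_derivative:
  fixes f :: "'a::euclidean_space \<Rightarrow> 'b::real_normed_vector"
  assumes "open S" "Ck_on (Suc k) f S" "Ck_on k X S"
  shows "Ck_on k (\<lambda>x. frechet_derivative f (at x) (X x)) S"
proof (rule Ck_on_cong[OF assms(1)])
  show "(\<Sum>b\<in>Basis. (X x \<bullet> b) *\<^sub>R frechet_derivative f (at x) b) = frechet_derivative f (at x) (X x)"
    if "x \<in> S" for x
    by (rule frechet_derivative_basis_expansion [symmetric]) (use assms(2) that in simp)
  show "Ck_on k (\<lambda>x. \<Sum>b\<in>Basis. (X x \<bullet> b) *\<^sub>R frechet_derivative f (at x) b) S"
  proof (rule Ck_on_sum[OF assms(1)])
    fix b :: 'a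
    have "Ck_on k (\<lambda>x. frechet_derivative f (at x) b) S"
      using assms(2) by simp
    then show "Ck_on k (\<lambda>x. (X x \<bullet> b) *\<^sub>R frechet_derivative f (at x) b) S"
      by (rule Ck_on_bounded_bilinear[OF bounded_bilinear_scaleR assms(1)
          Ck_on_bounded_linear[OF bounded_linear_inner_left assms(1,3)]])
  qed
qed

lemma Ck_on_compose:
  fixes g :: "'b::euclidean_space \<Rightarrow> 'c::real_normed_vector"
  assumes "open S" "Ck_on k f S" "Ck_on k g T" "f ` S \<subseteq> T"
  shows "Ck_on k (\<lambda>x. g (f x)) S"
  using assms(2,3)
proof (induction k arbitrary: g)
  case 0
  then show ?case using continuous_on_compose2[of T g S f] assms(4) by simp
next
  case (Suc k)
  show ?case
  proof (rule Ck_on_SucI[OF assms(1)])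
    have dg: "(g has_derivative frechet_derivative g (at (f x))) (at (f x))" if "x \<in> S" for x
      using that Suc.prems assms(4) by (intro has_frechet_derivative) auto
    show "((\<lambda>x. g (f x)) has_derivative
        (\<lambda>v. \<Sum>b\<in>Basis. (frechet_derivative f (at x) v \<bullet> b) *\<^sub>R frechet_derivative g (at (f x)) b)) (at x)"
      if "x \<in> S" for x
    proof -
      have "g differentiable (at (f x))"
        using dg[OF that] by (auto simp: differentiable_def)
      note frechet_derivative_basis_expansion[OF this, symmetric]
      moreover have "(f has_derivative frechet_derivative f (at x)) (at x)"
        using Suc.prems that by (intro has_frechet_derivative) simp
      then have "((\<lambda>x. g (f x)) has_derivative
        (\<lambda>v. frechet_derivative g (at (f x)) (frechet_derivative f (at x) v))) (at x)"
        using dg[OF that] by (rule has_derivative_compose)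
      ultimately show ?thesis
        by (simp only:)
    qed
    show "Ck_on k (\<lambda>x. \<Sum>b\<in>Basis. (frechet_derivative f (at x) v \<bullet> b) *\<^sub>R frechet_derivative g (at (f x)) b) S"
      for v
    proof -
      have "Ck_on k f S"
        using Suc.prems by (auto intro: Ck_on_SucD simp del: Ck_on.simps)
      moreover have "Ck_on k (\<lambda>y. frechet_derivative g (at y) b) T" for b
        using Suc.prems by simp
      ultimately have "Ck_on k (\<lambda>x. frechet_derivative g (at (f x)) b) S" for b
        by (rule Suc.IH)
      moreover have "Ck_on k (\<lambda>x. frechet_derivative f (at x) v \<bullet> b) S" for b
        using Suc.prems by (intro Ck_on_bounded_linear[OF bounded_linear_inner_left assms(1)]) simp
      ultimately show ?thesis
        by (intro Ck_on_sum[OF assms(1)] Ck_on_bounded_bilinear[OF bounded_bilinear_scaleR assms(1)])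
    qed
  qed
qed

text \<open>Real powers are treated all at once because this family, unlike the square root or the inverse alone, is closed under
differentiation up to scalars. Both of those are needed to normalise a frame.\<close>

lemma Ck_on_powr: "Ck_on k (\<lambda>x::real. x powr r) {0<..}"
proof (induction k arbitrary: r)
  case 0
  then show ?case by (auto intro!: continuous_intros)
next
  case (Suc k)
  show ?case
  proof (rule Ck_on_SucI)
    show "((\<lambda>x. x powr r) has_derivative (\<lambda>v. v * (r * x powr (r - 1)))) (at x)"
      if "x \<in> {0<..}" for x
      using has_real_derivative_powr[of x r] that
      by (simp add: has_field_derivative_def mult.commute[of _ "r * _"])
    show "Ck_on k (\<lambda>x. v * (r * x powr (r - 1))) {0<..}" for v
      using Ck_on_bounded_linear[OF bounded_linear_mult_right[of "v * r"] _ Suc.IH, of "r - 1"]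
      by (simp add: mult.assoc)
  qed simp
qed

lemma smooth_on_imp_differentiable: "smooth_on f S \<Longrightarrow> x \<in> S \<Longrightarrow> f differentiable (at x)"
  unfolding smooth_on_def by (metis Ck_on.simps(2))

lemma smooth_on_has_derivative:
  "smooth_on f S \<Longrightarrow> x \<in> S \<Longrightarrow> (f has_derivative frechet_derivative f (at x)) (at x)"
  by (intro has_frechet_derivative smooth_on_imp_differentiable)

lemma smooth_on_imp_continuous_on: "smooth_on f S \<Longrightarrow> continuous_on S f"
  unfolding smooth_on_def by (metis Ck_on.simps(1))

lemma smooth_on_cong:
  "open S \<Longrightarrow> (\<And>x. x \<in> S \<Longrightarrow> f x = g x) \<Longrightarrow> smooth_on f S \<Longrightarrow> smooth_on g S"
  unfolding smooth_on_def using Ck_on_cong by blast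

lemma smooth_on_subset: "smooth_on f S \<Longrightarrow> T \<subseteq> S \<Longrightarrow> smooth_on f T"
  unfolding smooth_on_def using Ck_on_subset by blast

lemma smooth_on_const [simp]: "smooth_on (\<lambda>x. c) S"
  unfolding smooth_on_def by simp

lemma smooth_on_bounded_linear:
  "bounded_linear L \<Longrightarrow> open S \<Longrightarrow> smooth_on f S \<Longrightarrow> smooth_on (\<lambda>x. L (f x)) S"
  unfolding smooth_on_def using Ck_on_bounded_linear by blast

lemma smooth_on_add:
  "open S \<Longrightarrow> smooth_on f S \<Longrightarrow> smooth_on g S \<Longrightarrow> smooth_on (\<lambda>x. f x + g x) S"
  unfolding smooth_on_def using Ck_on_add by blast

lemma smooth_on_minus: "open S \<Longrightarrow> smooth_on f S \<Longrightarrow> smooth_on (\<lambda>x. - f x) S"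
  using smooth_on_bounded_linear[OF bounded_linear_minus[OF bounded_linear_ident]] .

lemma smooth_on_diff:
  "open S \<Longrightarrow> smooth_on f S \<Longrightarrow> smooth_on g S \<Longrightarrow> smooth_on (\<lambda>x. f x - g x) S"
  using smooth_on_add[OF _ _ smooth_on_minus, of S f g] by simp

lemma smooth_on_bounded_bilinear:
  "bounded_bilinear B \<Longrightarrow> open S \<Longrightarrow> smooth_on f S \<Longrightarrow> smooth_on g S \<Longrightarrow> smooth_on (\<lambda>x. B (f x) (g x)) S"
  unfolding smooth_on_def using Ck_on_bounded_bilinear by blast

lemmas smooth_on_scaleR = smooth_on_bounded_bilinear[OF bounded_bilinear_scaleR]
lemmas smooth_on_mult = smooth_on_bounded_bilinear[OF bounded_bilinear_mult]

lemma smooth_on_sum: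
  "open S \<Longrightarrow> (\<And>i. i \<in> I \<Longrightarrow> smooth_on (f i) S) \<Longrightarrow> smooth_on (\<lambda>x. \<Sum>i\<in>I. f i x) S"
  unfolding smooth_on_def by (intro allI Ck_on_sum) auto

lemma smooth_on_frechet_derivative:
  fixes f :: "'a::euclidean_space \<Rightarrow> 'b::real_normed_vector"
  shows "open S \<Longrightarrow> smooth_on f S \<Longrightarrow> smooth_on X S \<Longrightarrow>
    smooth_on (\<lambda>x. frechet_derivative f (at x) (X x)) S"
  unfolding smooth_on_def using Ck_on_frechet_derivative by blast

lemma smooth_on_compose:
  fixes g :: "'b::euclidean_space \<Rightarrow> 'c::real_normed_vector"
  shows "open S \<Longrightarrow> smooth_on f S \<Longrightarrow> smooth_on g T \<Longrightarrow> f ` S \<subseteq> T \<Longrightarrow> smooth_on (\<lambda>x. g (f x)) S"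
  unfolding smooth_on_def using Ck_on_compose by blast

lemma smooth_on_powr:
  fixes f :: "'a::real_normed_vector \<Rightarrow> real"
  assumes "open S" "smooth_on f S" "\<And>x. x \<in> S \<Longrightarrow> f x > 0"
  shows "smooth_on (\<lambda>x. f x powr r) S"
proof (rule smooth_on_compose[OF assms(1,2)])
  show "smooth_on (\<lambda>x::real. x powr r) {0<..}"
    unfolding smooth_on_def using Ck_on_powr by blast
  show "f ` S \<subseteq> {0<..}"
    using assms(3) by auto
qed

lemma smooth_on_inverse:
  fixes f :: "'a::real_normed_vector \<Rightarrow> real"
  assumes "open S" "smooth_on f S" "\<And>x. x \<in> S \<Longrightarrow> f x \<noteq> 0"
  shows "smooth_on (\<lambda>x. inverse (f x)) S"
proof (rule smooth_on_cong[OF assms(1)])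
  \<comment> \<open>Powers are smooth on the positive axis only, so the sign is moved to a separate factor.\<close>
  show "f x * (f x * f x) powr - 1 = inverse (f x)" if "x \<in> S" for x
    using assms(3)[OF that] by (simp add: powr_minus field_simps)
  show "smooth_on (\<lambda>x. f x * (f x * f x) powr - 1) S"
  proof (intro smooth_on_mult smooth_on_powr assms(1,2))
    show "0 < f x * f x" if "x \<in> S" for x
      using assms(3)[OF that] by (simp flip: power2_eq_square)
  qed
qed

lemma smooth_onI_derivative:
  assumes "open S" "\<And>x. x \<in> S \<Longrightarrow> (f has_derivative f' x) (at x)" "\<And>v. smooth_on (\<lambda>x. f' x v) S"
  shows "smooth_on f S"
  unfolding smooth_on_def
proof
  fix k
  have "Ck_on (Suc k) f S"
    by (rule Ck_on_SucI[OF assms(1,2)]) (use assms(3) in \<open>auto simp: smooth_on_def\<close>)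
  then show "Ck_on k f S"
    by (rule Ck_on_SucD)
qed

text \<open>The second difference over a parallelogram is, by two applications of the mean value theorem, a second derivative at an
interior point. It is symmetric in the two sides, whereas the order of differentiation is not; comparing
both orders on shrinking parallelograms yields Schwarz's theorem.\<close>

lemma mixed_difference_mean_value:
  fixes f :: "'a::euclidean_space \<Rightarrow> real"
  assumes f: "smooth_on f S" and h: "0 < h"
    and sub: "\<And>s t. 0 \<le> s \<Longrightarrow> s \<le> h \<Longrightarrow> 0 \<le> t \<Longrightarrow> t \<le> h \<Longrightarrow> u + s *\<^sub>R a + t *\<^sub>R b \<in> S"
  obtains s t where "0 < s" "s < h" "0 < t" "t < h"
    "f (u + h *\<^sub>R a + h *\<^sub>R b) - f (u + h *\<^sub>R a) - f (u + h *\<^sub>R b) + f u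
      = h * h * frechet_derivative (\<lambda>x. frechet_derivative f (at x) a) (at (u + s *\<^sub>R a + t *\<^sub>R b)) b"
proof -
  have dfa: "smooth_on (\<lambda>x. frechet_derivative f (at x) a) S"
    using f unfolding smooth_on_def by (metis Ck_on.simps(2))
  have lin: "linear (frechet_derivative f (at x))" if "x \<in> S" for x
    using that by (intro linear_frechet_derivative smooth_on_imp_differentiable[OF f])
  have lin': "linear (frechet_derivative (\<lambda>x. frechet_derivative f (at x) a) (at x))" if "x \<in> S" for x
    using that by (intro linear_frechet_derivative smooth_on_imp_differentiable[OF dfa])
  have ds: "((\<lambda>s. f (u + s *\<^sub>R a + t *\<^sub>R b)) has_real_derivative
      frechet_derivative f (at (u + s *\<^sub>R a + t *\<^sub>R b)) a) (at s)"
    if "0 \<le> s" "s \<le> h" "0 \<le> t" "t \<le> h" for s t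
  proof -
    have "((\<lambda>s. f (u + s *\<^sub>R a + t *\<^sub>R b)) has_derivative
      (\<lambda>v. frechet_derivative f (at (u + s *\<^sub>R a + t *\<^sub>R b)) (v *\<^sub>R a))) (at s)"
    proof -
      have "((\<lambda>s. u + s *\<^sub>R a + t *\<^sub>R b) has_derivative (\<lambda>v. v *\<^sub>R a)) (at s)"
        by (auto intro!: derivative_eq_intros)
      then show ?thesis
        using smooth_on_has_derivative[OF f sub[OF that]] by (rule has_derivative_compose)
    qed
    then show ?thesis
      using linear_cmul[OF lin[OF sub[OF that]]]
      by (simp add: has_field_derivative_def mult.commute[of _ "frechet_derivative _ _ _"])
  qed
  have dt: "((\<lambda>t. frechet_derivative f (at (u + s *\<^sub>R a + t *\<^sub>R b)) a) has_real_derivative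
      frechet_derivative (\<lambda>x. frechet_derivative f (at x) a) (at (u + s *\<^sub>R a + t *\<^sub>R b)) b) (at t)"
    if "0 \<le> s" "s \<le> h" "0 \<le> t" "t \<le> h" for s t
  proof -
    have "((\<lambda>t. frechet_derivative f (at (u + s *\<^sub>R a + t *\<^sub>R b)) a) has_derivative
      (\<lambda>v. frechet_derivative (\<lambda>x. frechet_derivative f (at x) a) (at (u + s *\<^sub>R a + t *\<^sub>R b)) (v *\<^sub>R b))) (at t)"
    proof -
      have "((\<lambda>t. u + s *\<^sub>R a + t *\<^sub>R b) has_derivative (\<lambda>v. v *\<^sub>R b)) (at t)"
        by (auto intro!: derivative_eq_intros)
      then show ?thesis
        using smooth_on_has_derivative[OF dfa sub[OF that]] by (rule has_derivative_compose)
    qed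
    then show ?thesis
      using linear_cmul[OF lin'[OF sub[OF that]]]
      by (simp add: has_field_derivative_def mult.commute[of _ "frechet_derivative _ _ _"])
  qed
  let ?d = "\<lambda>s t. frechet_derivative f (at (u + s *\<^sub>R a + t *\<^sub>R b)) a"
  let ?g = "\<lambda>s. f (u + s *\<^sub>R a + h *\<^sub>R b) - f (u + s *\<^sub>R a + 0 *\<^sub>R b)"
  have "(?g has_real_derivative ?d s h - ?d s 0) (at s)" if "0 \<le> s" "s \<le> h" for s
    using h that by (intro DERIV_diff ds) auto
  from MVT2[OF h this] obtain s where s: "0 < s" "s < h" and
    "?g h - ?g 0 = (h - 0) * (?d s h - ?d s 0)"
    by blast
  moreover have "((\<lambda>t. ?d s t) has_real_derivative
      frechet_derivative (\<lambda>x. frechet_derivative f (at x) a) (at (u + s *\<^sub>R a + t *\<^sub>R b)) b) (at t)"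
    if "0 \<le> t" "t \<le> h" for t
    using s that by (intro dt) auto
  from MVT2[OF h this] obtain t where t: "0 < t" "t < h" and
    "?d s h - ?d s 0 = (h - 0) *
      frechet_derivative (\<lambda>x. frechet_derivative f (at x) a) (at (u + s *\<^sub>R a + t *\<^sub>R b)) b"
    by blast
  ultimately show thesis
    by (intro that[OF s t]) (simp add: algebra_simps)
qed

lemma small_parallelogram_near:
  fixes u a b :: "'a::real_normed_vector"
  assumes "0 < e"
  obtains h where "0 < h"
    "\<And>s t. 0 \<le> s \<Longrightarrow> s \<le> h \<Longrightarrow> 0 \<le> t \<Longrightarrow> t \<le> h \<Longrightarrow> dist (u + s *\<^sub>R a + t *\<^sub>R b) u < e"
proof
  define h where "h = e / (norm a + norm b + 1)"
  have pos: "norm a + norm b + 1 > 0"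
    by (smt (verit) norm_ge_zero)
  then show "0 < h" using assms by (simp add: h_def)
  fix s t :: real assume st: "0 \<le> s" "s \<le> h" "0 \<le> t" "t \<le> h"
  have "dist (u + s *\<^sub>R a + t *\<^sub>R b) u = norm (s *\<^sub>R a + t *\<^sub>R b)"
    by (simp add: dist_norm)
  also have "\<dots> \<le> s * norm a + t * norm b"
    using norm_triangle_ineq[of "s *\<^sub>R a" "t *\<^sub>R b"] st by simp
  also have "\<dots> \<le> h * norm a + h * norm b"
    using st by (intro add_mono mult_right_mono) auto
  also have "\<dots> < h * (norm a + norm b + 1)"
    using \<open>0 < h\<close> by (simp add: algebra_simps)
  also have "\<dots> = e"
    using pos by (simp add: h_def)
  finally show "dist (u + s *\<^sub>R a + t *\<^sub>R b) u < e" .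
qed

lemma second_derivative_symmetric_real:
  fixes f :: "'a::euclidean_space \<Rightarrow> real"
  assumes f: "smooth_on f S" and "open S" "u \<in> S"
  shows "frechet_derivative (\<lambda>x. frechet_derivative f (at x) a) (at u) b
    = frechet_derivative (\<lambda>x. frechet_derivative f (at x) b) (at u) a" (is "?D a b u = ?D b a u")
proof (rule ccontr)
  assume neq: "?D a b u \<noteq> ?D b a u"
  define r where "r = \<bar>?D a b u - ?D b a u\<bar> / 2"
  have "r > 0" using neq by (simp add: r_def)
  have cont: "continuous_on S (?D a b)" for a b
    using f unfolding smooth_on_def by (metis Ck_on.simps)
  have near: "\<exists>e>0. \<forall>x. dist x u < e \<longrightarrow> x \<in> S \<and> \<bar>?D a b x - ?D a b u\<bar> < r" for a b
  proof -
    obtain e1 where "e1 > 0" "\<And>x. dist x u < e1 \<Longrightarrow> x \<in> S"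
      using assms(2,3) open_dist by metis
    moreover obtain e2 where "e2 > 0" "\<And>x. x \<in> S \<Longrightarrow> dist x u < e2 \<Longrightarrow> \<bar>?D a b x - ?D a b u\<bar> < r"
      using cont[of a b] \<open>r > 0\<close> assms(3) unfolding continuous_on_iff dist_real_def by metis
    ultimately show ?thesis
      by (intro exI[of _ "min e1 e2"]) auto
  qed
  obtain e where e: "e > 0" "\<And>x. dist x u < e \<Longrightarrow> x \<in> S" "\<And>x. dist x u < e \<Longrightarrow> \<bar>?D a b x - ?D a b u\<bar> < r"
    using near[of a b] by blast
  obtain e' where e': "e' > 0" "\<And>x. dist x u < e' \<Longrightarrow> \<bar>?D b a x - ?D b a u\<bar> < r"
    using near[of b a] by blast
  obtain h where h: "0 < h" "\<And>s t. 0 \<le> s \<Longrightarrow> s \<le> h \<Longrightarrow> 0 \<le> t \<Longrightarrow> t \<le> h \<Longrightarrow>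
      dist (u + s *\<^sub>R a + t *\<^sub>R b) u < min e e'"
    using small_parallelogram_near[of "min e e'" u a b] e(1) e'(1) by (metis min_less_iff_conj)
  have h': "dist (u + s *\<^sub>R b + t *\<^sub>R a) u < min e e'"
    if "0 \<le> s" "s \<le> h" "0 \<le> t" "t \<le> h" for s t
    using h(2)[OF that(3,4,1,2)] by (simp add: algebra_simps)
  obtain s t where st: "0 < s" "s < h" "0 < t" "t < h"
    "f (u + h *\<^sub>R a + h *\<^sub>R b) - f (u + h *\<^sub>R a) - f (u + h *\<^sub>R b) + f u = h * h * ?D a b (u + s *\<^sub>R a + t *\<^sub>R b)"
    using mixed_difference_mean_value[OF f h(1), of u a b] h(2) e(2) by (metis min_less_iff_conj)
  obtain s' t' where st': "0 < s'" "s' < h" "0 < t'" "t' < h"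
    "f (u + h *\<^sub>R b + h *\<^sub>R a) - f (u + h *\<^sub>R b) - f (u + h *\<^sub>R a) + f u = h * h * ?D b a (u + s' *\<^sub>R b + t' *\<^sub>R a)"
    using mixed_difference_mean_value[OF f h(1), of u b a] h' e(2) by (metis min_less_iff_conj)
  have "h * h * ?D a b (u + s *\<^sub>R a + t *\<^sub>R b) = h * h * ?D b a (u + s' *\<^sub>R b + t' *\<^sub>R a)"
    using st(5) st'(5) by (simp add: algebra_simps)
  then have "?D a b (u + s *\<^sub>R a + t *\<^sub>R b) = ?D b a (u + s' *\<^sub>R b + t' *\<^sub>R a)"
    using h(1) by simp
  moreover have "\<bar>?D a b (u + s *\<^sub>R a + t *\<^sub>R b) - ?D a b u\<bar> < r"
    using st h(2)[of s t] by (intro e(3)) auto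
  moreover have "\<bar>?D b a (u + s' *\<^sub>R b + t' *\<^sub>R a) - ?D b a u\<bar> < r"
    using st' h'[of s' t'] by (intro e'(2)) auto
  ultimately show False
    unfolding r_def by (smt (verit) field_sum_of_halves)
qed

lemma second_derivative_symmetric:
  fixes f :: "'a::euclidean_space \<Rightarrow> 'b::euclidean_space"
  assumes f: "smooth_on f S" and "open S" "u \<in> S"
  shows "frechet_derivative (\<lambda>x. frechet_derivative f (at x) a) (at u) b
    = frechet_derivative (\<lambda>x. frechet_derivative f (at x) b) (at u) a"
proof (rule euclidean_eqI)
  fix i :: 'b
  assume "i \<in> Basis"
  have D: "frechet_derivative (\<lambda>x. g x \<bullet> i) (at x) v = frechet_derivative g (at x) v \<bullet> i"
    if "smooth_on g S" "x \<in> S" for g :: "'a \<Rightarrow> 'b" and x v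
    using smooth_on_has_derivative[OF that]
    by (subst frechet_derivative_eq[OF has_derivative_inner_left]) auto
  have sm: "smooth_on (\<lambda>x. frechet_derivative f (at x) a) S" for a
    using assms by (intro smooth_on_frechet_derivative) auto
  have "frechet_derivative (\<lambda>x. frechet_derivative f (at x) a) (at u) b \<bullet> i
    = frechet_derivative (\<lambda>x. frechet_derivative (\<lambda>x. f x \<bullet> i) (at x) a) (at u) b" for a b
    unfolding D[OF sm assms(3), symmetric]
    by (subst frechet_derivative_cong_open[OF assms(2,3)]) (use D[OF f] in auto)
  then show "frechet_derivative (\<lambda>x. frechet_derivative f (at x) a) (at u) b \<bullet> i
    = frechet_derivative (\<lambda>x. frechet_derivative f (at x) b) (at u) a \<bullet> i"
    using second_derivative_symmetric_real[of "\<lambda>x. f x \<bullet> i" S u a b] assms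
      smooth_on_bounded_linear[OF bounded_linear_inner_left assms(2) f] by simp
qed

text \<open>The Poincare lemma on a ball, for the 1-form \<open>v \<mapsto> w u \<bullet> v\<close>. The potential is the integral of the form along the segment from the
centre. Differentiating under the integral sign and using closedness turns the integrand into the
\<open>t\<close>-derivative of \<open>t (w (c + t (u - c)) \<bullet> v)\<close>.\<close>

lemma closed_form_has_potential:
  fixes w :: "'a::euclidean_space \<Rightarrow> 'a"
  assumes w: "smooth_on w (ball c r)" and "r > 0"
    and closed: "\<And>u a b. u \<in> ball c r \<Longrightarrow>
      frechet_derivative w (at u) a \<bullet> b = frechet_derivative w (at u) b \<bullet> a"
  obtains h where "\<And>u. u \<in> ball c r \<Longrightarrow> (h has_derivative (\<lambda>v. w u \<bullet> v)) (at u)"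
proof
  define S where "S = ball c r"
  define p where "p = (\<lambda>u t. c + t *\<^sub>R (u - c))"
  define h where "h = (\<lambda>u. integral (cbox 0 1) (\<lambda>t::real. w (p u t) \<bullet> (u - c)))"
  define f' where "f' = (\<lambda>u t v. w (p u t) \<bullet> v + frechet_derivative w (at (p u t)) (t *\<^sub>R v) \<bullet> (u - c))"
  fix u assume u: "u \<in> ball c r"
  have opS: "open S" and cvS: "convex S" and uS: "u \<in> S" using u by (auto simp: S_def)
  have wS: "smooth_on w S" using w by (simp add: S_def)
  have pS: "p x t \<in> S" if "x \<in> S" "t \<in> cbox 0 1" for x t
  proof -
    have "(1 - t) *\<^sub>R c + t *\<^sub>R x \<in> S"
      using that \<open>r > 0\<close> by (intro convexD_alt[OF cvS]) (auto simp: S_def)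
    then show ?thesis by (simp add: p_def algebra_simps)
  qed
  have Dw: "(w has_derivative frechet_derivative w (at x)) (at x)" if "x \<in> S" for x
    using smooth_on_has_derivative[OF wS that] .
  have f'_lin: "bounded_linear (f' x t)" if "x \<in> S" "t \<in> cbox 0 1" for x t
  proof -
    have "bounded_linear (frechet_derivative w (at (p x t)))"
      using Dw[OF pS[OF that]] by (rule has_derivative_bounded_linear)
    then show ?thesis
      unfolding f'_def
      by (rule bounded_linear_add[OF bounded_linear_inner_right bounded_linear_compose[OF
          bounded_linear_inner_left bounded_linear_compose[OF _ bounded_linear_scaleR_right]]])
  qed
  have f'_deriv: "((\<lambda>x. w (p x t) \<bullet> (x - c)) has_derivative f' x t) (at x)"
    if "x \<in> S" "t \<in> cbox 0 1" for x t
  proof -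
    have "((\<lambda>x. p x t) has_derivative (\<lambda>v. t *\<^sub>R v)) (at x)"
      unfolding p_def by (auto intro!: derivative_eq_intros)
    then have "((\<lambda>x. w (p x t)) has_derivative (\<lambda>v. frechet_derivative w (at (p x t)) (t *\<^sub>R v))) (at x)"
      using Dw[OF pS[OF that]] by (rule has_derivative_compose)
    then show ?thesis
      unfolding f'_def by (auto intro!: derivative_eq_intros)
  qed
  define F' where "F' = (\<lambda>x t. Blinfun (f' x t))"
  have F'_apply: "blinfun_apply (F' x t) = f' x t" if "x \<in> S" "t \<in> cbox 0 1" for x t
    unfolding F'_def using f'_lin[OF that] by (rule bounded_linear_Blinfun_apply)
  have cont_p: "continuous_on (S \<times> cbox 0 1) (\<lambda>(x, t). p x t)"
    unfolding p_def split_beta by (intro continuous_intros)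
  have cont_f': "continuous_on (S \<times> cbox 0 1) (\<lambda>(x, t). f' x t v)" for v
  proof -
    have "continuous_on S w" "continuous_on S (\<lambda>x. frechet_derivative w (at x) v)"
      using smooth_on_imp_continuous_on[OF wS]
        smooth_on_imp_continuous_on[OF smooth_on_frechet_derivative[OF opS wS smooth_on_const]] by auto
    moreover have "continuous_on (S \<times> cbox 0 1) (\<lambda>z. p (fst z) (snd z))"
      using cont_p by (simp add: split_beta)
    moreover have "(\<lambda>z. p (fst z) (snd z)) ` (S \<times> cbox 0 1) \<subseteq> S"
      using pS by auto
    ultimately have c: "continuous_on (S \<times> cbox 0 1) (\<lambda>z. w (p (fst z) (snd z)))"
      "continuous_on (S \<times> cbox 0 1) (\<lambda>z. frechet_derivative w (at (p (fst z) (snd z))) v)"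
      using continuous_on_compose2[of S _ "S \<times> cbox 0 1" "\<lambda>z. p (fst z) (snd z)"] by blast+
    have "continuous_on (S \<times> cbox 0 1)
      (\<lambda>z. w (p (fst z) (snd z)) \<bullet> v + (snd z *\<^sub>R frechet_derivative w (at (p (fst z) (snd z))) v) \<bullet> (fst z - c))"
      by (intro continuous_intros c)
    then show ?thesis
    proof (rule continuous_on_eq)
      fix z :: "'a \<times> real" assume z: "z \<in> S \<times> cbox 0 1"
      obtain x t where [simp]: "z = (x, t)" by (cases z)
      have "linear (frechet_derivative w (at (p x t)))"
        using z by (intro has_derivative_linear[OF Dw[OF pS]]) auto
      then show "w (p (fst z) (snd z)) \<bullet> v + (snd z *\<^sub>R frechet_derivative w (at (p (fst z) (snd z))) v) \<bullet> (fst z - c)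
        = (case z of (x, t) \<Rightarrow> f' x t v)"
        by (simp add: f'_def linear_cmul)
    qed
  qed
  have deriv: "(h has_derivative integral (cbox 0 1) (F' u)) (at u within S)"
    unfolding h_def
  proof (rule leibniz_rule[OF _ _ _ uS cvS])
    show "((\<lambda>x. w (p x t) \<bullet> (x - c)) has_derivative blinfun_apply (F' x t)) (at x within S)"
      if "x \<in> S" "t \<in> cbox 0 1" for x t
      using f'_deriv[OF that] F'_apply[OF that] has_derivative_at_withinI by simp
    show "(\<lambda>t. w (p x t) \<bullet> (x - c)) integrable_on cbox 0 1" if "x \<in> S" for x
    proof (rule integrable_continuous)
      have "continuous_on (cbox 0 1) (\<lambda>t. w (p x t))"
        using smooth_on_imp_continuous_on[OF wS] pS[OF that]
        by (auto intro!: continuous_on_compose2[of S w] continuous_intros simp: p_def)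
      then show "continuous_on (cbox 0 1) (\<lambda>t. w (p x t) \<bullet> (x - c))"
        by (intro continuous_intros)
    qed
    show "continuous_on (S \<times> cbox 0 1) (\<lambda>(x, t). F' x t)"
    proof (rule continuous_on_blinfun_componentwise)
      fix i :: 'a
      show "continuous_on (S \<times> cbox 0 1) (\<lambda>z. blinfun_apply (case z of (x, t) \<Rightarrow> F' x t) i)"
        by (rule continuous_on_eq[OF cont_f'[of i]]) (auto simp: F'_apply)
    qed
  qed
  have cF: "continuous_on (cbox 0 1) (F' u)"
  proof (rule continuous_on_blinfun_componentwise)
    fix i :: 'a
    have "continuous_on (cbox 0 1) (\<lambda>t. f' u t i)"
    proof -
      have "continuous_on (cbox 0 1) (\<lambda>t::real. (u, t))"
        by (rule continuous_on_Pair[OF continuous_on_const continuous_on_id])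
      moreover have "(\<lambda>t. (u, t)) ` cbox 0 1 \<subseteq> S \<times> cbox 0 1"
        using uS by auto
      ultimately show ?thesis
        using continuous_on_compose2[OF cont_f'[of i]] by fastforce
    qed
    then show "continuous_on (cbox 0 1) (\<lambda>t. blinfun_apply (F' u t) i)"
      by (rule continuous_on_eq) (simp add: F'_apply uS)
  qed
  have "blinfun_apply (integral (cbox 0 1) (F' u)) v = w u \<bullet> v" for v
  proof -
    have "blinfun_apply (integral (cbox 0 1) (F' u)) v = integral (cbox 0 1) (\<lambda>t. blinfun_apply (F' u t) v)"
      by (rule blinfun_apply_integral[OF integrable_continuous[OF cF]])
    also have "\<dots> = integral (cbox 0 1) (\<lambda>t. f' u t v)"
      by (rule integral_cong) (simp add: F'_apply uS)
    also have "\<dots> = 1 *\<^sub>R (w (p u 1) \<bullet> v) - 0 *\<^sub>R (w (p u 0) \<bullet> v)"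
    proof (rule integral_unique, unfold cbox_interval, rule fundamental_theorem_of_calculus)
      fix t :: real assume t: "t \<in> {0..1}"
      have "((\<lambda>t. p u t) has_derivative (\<lambda>s. s *\<^sub>R (u - c))) (at t)"
        unfolding p_def by (auto intro!: derivative_eq_intros)
      moreover have pt: "p u t \<in> S" using pS[OF uS] t by simp
      ultimately have "((\<lambda>t. w (p u t)) has_derivative
          (\<lambda>s. frechet_derivative w (at (p u t)) (s *\<^sub>R (u - c)))) (at t)"
        using has_derivative_compose Dw by blast
      then have "((\<lambda>t. w (p u t)) has_derivative (\<lambda>s. s *\<^sub>R frechet_derivative w (at (p u t)) (u - c))) (at t)"
        using linear_cmul[OF has_derivative_linear[OF Dw[OF pt]]] by simp
      then have "((\<lambda>t. t *\<^sub>R (w (p u t) \<bullet> v)) has_derivative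
          (\<lambda>s. s *\<^sub>R (t *\<^sub>R (frechet_derivative w (at (p u t)) (u - c) \<bullet> v) + w (p u t) \<bullet> v))) (at t)"
        by (auto intro!: derivative_eq_intros simp: algebra_simps)
      moreover have "t *\<^sub>R (frechet_derivative w (at (p u t)) (u - c) \<bullet> v) + w (p u t) \<bullet> v = f' u t v"
        using closed[of "p u t" "u - c" v] pt linear_cmul[OF has_derivative_linear[OF Dw[OF pt]]]
        by (simp add: f'_def S_def)
      ultimately show "((\<lambda>t. t *\<^sub>R (w (p u t) \<bullet> v)) has_vector_derivative f' u t v) (at t within {0..1})"
        by (auto simp: has_vector_derivative_def intro: has_derivative_at_withinI)
    qed simp
    also have "\<dots> = w u \<bullet> v"
      by (simp add: p_def)
    finally show ?thesis .
  qed
  then have "blinfun_apply (integral (cbox 0 1) (F' u)) = (\<lambda>v. w u \<bullet> v)" by blast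
  then show "(h has_derivative (\<lambda>v. w u \<bullet> v)) (at u)"
    using deriv at_within_open[OF uS opS] by simp
qed

section \<open>The metric and the complex structure\<close>

lemma J_component [simp]: "J z $ i = \<i> * z $ i"
  by (simp add: J_def)

lemma bounded_linear_J: "bounded_linear J"
  unfolding linear_conv_bounded_linear[symmetric]
  by (rule linearI) (auto simp: vec_eq_iff algebra_simps)

lemma J_simps [simp]:
  "J (z + w) = J z + J w" "J (z - w) = J z - J w" "J (- z) = - J z" "J (r *\<^sub>R z) = r *\<^sub>R J z" "J 0 = 0"
  "J (J z) = - z"
  by (auto simp: vec_eq_iff algebra_simps)

lemma lorentz_eq: "lorentz z w = - (Re (z$1) * Re (w$1) + Im (z$1) * Im (w$1))
    + (Re (z$2) * Re (w$2) + Im (z$2) * Im (w$2))"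
  by (simp add: lorentz_def)

lemma bounded_bilinear_lorentz: "bounded_bilinear lorentz"
  unfolding bilinear_conv_bounded_bilinear[symmetric] bilinear_def
  by (auto intro!: linearI simp: lorentz_eq algebra_simps)

lemma lorentz_simps [simp]:
  "lorentz (x + y) z = lorentz x z + lorentz y z" "lorentz z (x + y) = lorentz z x + lorentz z y"
  "lorentz (x - y) z = lorentz x z - lorentz y z" "lorentz z (x - y) = lorentz z x - lorentz z y"
  "lorentz (- x) z = - lorentz x z" "lorentz z (- x) = - lorentz z x"
  "lorentz (r *\<^sub>R x) z = r * lorentz x z" "lorentz z (r *\<^sub>R x) = r * lorentz z x"
  "lorentz 0 z = 0" "lorentz z 0 = 0"
  by (auto simp: lorentz_eq algebra_simps)

lemma lorentz_commute: "lorentz z w = lorentz w z"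
  by (simp add: lorentz_eq algebra_simps)

lemma lorentz_J_J [simp]: "lorentz (J z) (J w) = lorentz z w"
  by (simp add: lorentz_eq algebra_simps)

lemma lorentz_J_left: "lorentz (J z) w = - lorentz z (J w)"
  by (simp add: lorentz_eq algebra_simps)

lemma lorentz_J_self [simp]: "lorentz z (J z) = 0" "lorentz (J z) z = 0"
  by (simp_all add: lorentz_eq)

lemma lorentz_sum_left: "lorentz (\<Sum>i\<in>A. g i) z = (\<Sum>i\<in>A. lorentz (g i) z)"
  by (induction A rule: infinite_finite_induct) auto

text \<open>A null pair isotropic for the symplectic form \<open>\<langle>v, J w\<rangle>\<close> is a basis over the complex numbers: its Gram matrix for the Hermitian
product, whose real and imaginary parts are the metric and the symplectic form, has determinant \<open>- 1\<close>.\<close>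

lemma orthogonal_to_null_pair_imp_zero:
  assumes a: "lorentz a a = 0" and b: "lorentz b b = 0" and ab: "lorentz a b = - 1"
    and Jab: "lorentz a (J b) = 0"
    and r: "lorentz r a = 0" "lorentz r b = 0" "lorentz r (J a) = 0" "lorentz r (J b) = 0"
  shows "r = 0"
proof -
  have herm: "- (z$1) * cnj (w$1) + z$2 * cnj (w$2) = Complex (lorentz z w) (lorentz z (J w))" for z w
    by (simp add: complex_eq_iff lorentz_eq algebra_simps)
  have aa: "a$1 * cnj (a$1) = a$2 * cnj (a$2)"
    using herm[of a a] a by (simp add: complex_eq_iff)
  have ab': "a$1 * cnj (b$1) - a$2 * cnj (b$2) = 1"
    using herm[of a b] ab Jab by (simp add: complex_eq_iff)
  have ra: "r$1 * cnj (a$1) = r$2 * cnj (a$2)"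
    using herm[of r a] r by (simp add: complex_eq_iff)
  have rb: "r$1 * cnj (b$1) = r$2 * cnj (b$2)"
    using herm[of r b] r by (simp add: complex_eq_iff)
  have ne: "a$1 \<noteq> 0" "a$2 \<noteq> 0"
    using ab' aa by auto
  have "cnj (a$1) * (a$2 * r$1 - a$1 * r$2) = a$2 * (r$1 * cnj (a$1)) - (a$1 * cnj (a$1)) * r$2"
    by (simp add: algebra_simps)
  also have "\<dots> = 0"
    unfolding ra aa by (simp add: algebra_simps)
  finally have det: "a$1 * r$2 = a$2 * r$1"
    using ne by simp
  have "r$2 = r$2 * (a$1 * cnj (b$1) - a$2 * cnj (b$2))"
    using ab' by simp
  also have "\<dots> = (a$1 * r$2) * cnj (b$1) - a$2 * (r$2 * cnj (b$2))"
    by (simp add: algebra_simps)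
  also have "\<dots> = 0"
    unfolding det rb[symmetric] by (simp add: algebra_simps)
  finally have "r$2 = 0" .
  then have "r$1 = 0"
    using det ne by simp
  with \<open>r$2 = 0\<close> show ?thesis
    by (simp add: vec_eq_iff forall_2)
qed

text \<open>The coefficients are crossed because in the dual basis of a null pair each vector is, up to sign, the other one.\<close>

lemma null_pair_expansion:
  assumes "lorentz a a = 0" "lorentz b b = 0" "lorentz a b = - 1" "lorentz a (J b) = 0"
  shows "w = - lorentz w b *\<^sub>R a - lorentz w a *\<^sub>R b - lorentz w (J b) *\<^sub>R J a - lorentz w (J a) *\<^sub>R J b"
    (is "w = ?e")
proof -
  have "w - ?e = 0"
    by (rule orthogonal_to_null_pair_imp_zero[OF assms])
      (use assms lorentz_commute[of b a] lorentz_J_left[of a b] lorentz_J_left[of b a]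
         lorentz_commute[of "J b" a] lorentz_commute[of "J a" b] in auto)
  then show ?thesis
    by simp
qed

section \<open>Second derivatives and the Levi-Civita connection\<close>

text \<open>The matrix of second derivatives as a bilinear map; the first vector is the direction of the outer derivative.\<close>

definition hessian :: "(real^2 \<Rightarrow> 'b::real_normed_vector) \<Rightarrow> real^2 \<Rightarrow> real^2 \<Rightarrow> real^2 \<Rightarrow> 'b" where
  "hessian s u a b = frechet_derivative (\<lambda>x. frechet_derivative s (at x) b) (at u) a"

lemma frechet_derivative_bilinear:
  assumes "bounded_bilinear B" "g differentiable (at u)" "h differentiable (at u)"
  shows "frechet_derivative (\<lambda>x. B (g x) (h x)) (at u) v
    = B (g u) (frechet_derivative h (at u) v) + B (frechet_derivative g (at u) v) (h u)"
  by (subst frechet_derivative_eq[OF bounded_bilinear.FDERIV[OF assms(1) has_frechet_derivative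
          has_frechet_derivative]]) (use assms in auto)

lemma frechet_derivative_bounded_linear:
  assumes "bounded_linear L" "g differentiable (at u)"
  shows "frechet_derivative (\<lambda>x. L (g x)) (at u) v = L (frechet_derivative g (at u) v)"
  by (subst frechet_derivative_eq[OF bounded_linear.has_derivative[OF assms(1) has_frechet_derivative]])
    (use assms in auto)

lemma frechet_derivative_sum:
  assumes "\<And>i. i \<in> I \<Longrightarrow> g i differentiable (at u)"
  shows "frechet_derivative (\<lambda>x. \<Sum>i\<in>I. g i x) (at u) v = (\<Sum>i\<in>I. frechet_derivative (g i) (at u) v)"
  by (subst frechet_derivative_eq[OF has_derivative_sum[OF has_frechet_derivative]])
    (use assms in auto)

context
  fixes s :: "real^2 \<Rightarrow> 'b::euclidean_space" and S u
  assumes s: "smooth_on s S" and S: "open S" and u: "u \<in> S"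
begin

lemma linear_hessian_left: "linear (\<lambda>a. hessian s u a b)"
proof -
  have "smooth_on (\<lambda>x. frechet_derivative s (at x) b) S"
    by (rule smooth_on_frechet_derivative[OF S s smooth_on_const])
  then show ?thesis
    unfolding hessian_def
    using linear_frechet_derivative smooth_on_imp_differentiable u by blast
qed

lemma hessian_commute: "hessian s u a b = hessian s u b a"
  unfolding hessian_def by (rule second_derivative_symmetric[OF s S u])

lemma linear_hessian_right: "linear (hessian s u a)"
  using linear_hessian_left[of a] hessian_commute[of a] by presburger

text \<open>The product rule for a derivative along a field: the term in which the field itself is differentiated is split off,
which leaves a bilinear expression in the values of the fields.\<close>

lemma derivative_along_field:
  assumes Y: "smooth_on Y S"
  shows "frechet_derivative (\<lambda>x. frechet_derivative s (at x) (Y x)) (at u) a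
    = hessian s u a (Y u) + frechet_derivative s (at u) (frechet_derivative Y (at u) a)"
proof -
  let ?c = "\<lambda>b x. Y x \<bullet> b" and ?d = "\<lambda>b x. frechet_derivative s (at x) b"
  have d: "?d b differentiable (at u)" for b
    using smooth_on_imp_differentiable[OF smooth_on_frechet_derivative[OF S s smooth_on_const] u] .
  have Yd: "Y differentiable (at u)"
    using smooth_on_imp_differentiable[OF Y u] .
  have c: "?c b differentiable (at u)" "frechet_derivative (?c b) (at u) a = frechet_derivative Y (at u) a \<bullet> b" for b
    using smooth_on_imp_differentiable[OF smooth_on_bounded_linear[OF bounded_linear_inner_left S Y] u]
      frechet_derivative_bounded_linear[OF bounded_linear_inner_left Yd] by auto
  have cd: "(\<lambda>x. ?c b x *\<^sub>R ?d b x) differentiable (at u)" for b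
    using c d by (intro differentiable_scaleR)
  have "frechet_derivative (\<lambda>x. frechet_derivative s (at x) (Y x)) (at u) a
    = frechet_derivative (\<lambda>x. \<Sum>b\<in>Basis. ?c b x *\<^sub>R ?d b x) (at u) a"
    by (subst frechet_derivative_cong_open[OF S u])
      (auto intro!: frechet_derivative_basis_expansion smooth_on_imp_differentiable[OF s])
  also have "\<dots> = (\<Sum>b\<in>Basis. ?c b u *\<^sub>R hessian s u a b + (frechet_derivative Y (at u) a \<bullet> b) *\<^sub>R ?d b u)"
    unfolding frechet_derivative_sum[OF cd]
    by (simp add: frechet_derivative_bilinear[OF bounded_bilinear_scaleR c(1) d] c(2) hessian_def)
  also have "\<dots> = hessian s u a (Y u) + frechet_derivative s (at u) (frechet_derivative Y (at u) a)"
    unfolding sum.distrib linear_basis_expansion[OF linear_hessian_right, symmetric]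
    by (rule arg_cong[OF frechet_derivative_basis_expansion[symmetric]])
      (rule smooth_on_imp_differentiable[OF s u])
  finally show ?thesis .
qed

end

text \<open>The Christoffel part of the Levi-Civita connection, which depends on the values of the two fields only.\<close>

definition christoffel_vector :: "(real^2 \<Rightarrow> complex^2) \<Rightarrow> real^2 \<Rightarrow> real^2 \<Rightarrow> real^2 \<Rightarrow> real^2" where
  "christoffel_vector f u a b = (\<chi> k. \<Sum>i\<in>UNIV. \<Sum>j\<in>UNIV. christoffel f u k i j * a $ i * b $ j)"

lemma levi_civita_eq:
  "levi_civita f X Y u = differential Y u (X u) + christoffel_vector f u (X u) (Y u)"
  by (simp add: levi_civita_def christoffel_vector_def)

lemma bilinear_christoffel_vector: "bilinear (christoffel_vector f u)"
  unfolding bilinear_def christoffel_vector_def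
  by (auto intro!: linearI simp: vec_eq_iff sum_2 algebra_simps)

lemma vec2_expansion: "(v :: real^2) = v$1 *\<^sub>R axis 1 1 + v$2 *\<^sub>R axis 2 1"
  by (simp add: vec_eq_iff forall_2 axis_def)

context
  fixes f :: "real^2 \<Rightarrow> complex^2" and S u
  assumes f: "smooth_on f S" and S: "open S" and u: "u \<in> S"
begin

lemma linear_differential: "linear (differential f u)"
  by (rule linear_frechet_derivative[OF smooth_on_imp_differentiable[OF f u]])

lemma derivative_gram:
  "differential (\<lambda>x. gram f x $ i $ j) u v =
    lorentz (hessian f u v (axis i 1)) (differential f u (axis j 1))
    + lorentz (differential f u (axis i 1)) (hessian f u v (axis j 1))"
proof -
  have d: "(\<lambda>x. differential f x a) differentiable (at u)" for a
    using smooth_on_imp_differentiable[OF smooth_on_frechet_derivative[OF S f smooth_on_const] u] .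
  show ?thesis
    unfolding gram_def induced_metric_def
    by (simp add: frechet_derivative_bilinear[OF bounded_bilinear_lorentz d d] hessian_def)
qed

lemma gram_commute: "gram f u $ i $ j = gram f u $ j $ i"
  by (simp add: gram_def induced_metric_def lorentz_commute)

lemma invertible_gram:
  assumes "nondegenerate f u"
  shows "matrix_inv (gram f u) ** gram f u = mat 1"
proof -
  have "v = 0" if v: "gram f u *v v = 0" for v
  proof -
    have *: "induced_metric f u (axis i 1) v = 0" for i
    proof -
      have "induced_metric f u (axis i 1) v = (gram f u *v v) $ i"
        by (subst vec2_expansion[of v])
          (simp add: induced_metric_def linear_add[OF linear_differential] linear_cmul[OF linear_differential]
            matrix_vector_mult_def sum_2 gram_def)
      then show ?thesis using v by simp
    qed
    have "induced_metric f u v w = 0" for w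
      using *[of 1] *[of 2]
      by (subst vec2_expansion[of w])
        (simp add: induced_metric_def linear_add[OF linear_differential] linear_cmul[OF linear_differential]
          lorentz_commute[of "differential f u v"])
    then show ?thesis
      using assms unfolding nondegenerate_def by blast
  qed
  then have "invertible (gram f u)"
    unfolding invertible_left_inverse matrix_left_invertible_ker by blast
  then show ?thesis
    unfolding invertible_def matrix_inv_def by (rule someI2_ex) blast
qed

text \<open>The Koszul formula. For an induced metric, \<open>\<partial>\<^sub>i g\<^sub>j\<^sub>m = \<langle>f\<^sub>i\<^sub>j, f\<^sub>m\<rangle> + \<langle>f\<^sub>j, f\<^sub>i\<^sub>m\<rangle>\<close>, and in the alternating sum all terms cancel except
those in which \<open>f\<^sub>i\<^sub>j\<close> occurs.\<close>

lemma christoffel_lowered: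
  assumes "nondegenerate f u"
  shows "(\<Sum>k\<in>UNIV. christoffel f u k i j * gram f u $ k $ m)
    = lorentz (hessian f u (axis i 1) (axis j 1)) (differential f u (axis m 1))"
proof -
  let ?K = "\<lambda>l. lorentz (hessian f u (axis i 1) (axis j 1)) (differential f u (axis l 1))"
  have c: "christoffel f u k i j = (\<Sum>l\<in>UNIV. matrix_inv (gram f u) $ k $ l * ?K l)" for k
    unfolding christoffel_def derivative_gram sum_divide_distrib
    by (rule sum.cong)
      (simp_all add: hessian_commute[OF f S u] lorentz_commute algebra_simps)
  have inv: "(\<Sum>k\<in>UNIV. gram f u $ m $ k * matrix_inv (gram f u) $ k $ l) = (if m = l then 1 else 0)" for l
  proof -
    have "gram f u ** matrix_inv (gram f u) = mat 1"
      using invertible_gram[OF assms] by (simp add: matrix_left_right_inverse)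
    then have "(gram f u ** matrix_inv (gram f u)) $ m $ l = mat 1 $ m $ l"
      by simp
    then show ?thesis
      by (simp add: matrix_matrix_mult_def mat_def)
  qed
  have "(\<Sum>k\<in>UNIV. christoffel f u k i j * gram f u $ k $ m)
    = (\<Sum>k\<in>UNIV. \<Sum>l\<in>UNIV. gram f u $ m $ k * matrix_inv (gram f u) $ k $ l * ?K l)"
    unfolding c by (simp add: sum_distrib_right sum_distrib_left gram_commute[of _ m] mult_ac)
  also have "\<dots> = (\<Sum>l\<in>UNIV. (\<Sum>k\<in>UNIV. gram f u $ m $ k * matrix_inv (gram f u) $ k $ l) * ?K l)"
    by (subst sum.swap) (simp add: sum_distrib_right)
  also have "\<dots> = ?K m"
    unfolding inv by (simp add: if_distrib[of "\<lambda>x. x * _"] sum.delta cong: if_cong)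
  finally show ?thesis .
qed

text \<open>The Gauss formula: the intrinsically defined Christoffel term is the tangential part of the second derivative of the
immersion.\<close>

lemma christoffel_vector_is_projection:
  assumes "nondegenerate f u"
  shows "lorentz (differential f u (christoffel_vector f u a b)) (differential f u c)
    = lorentz (hessian f u a b) (differential f u c)"
proof -
  have m: "lorentz (differential f u (christoffel_vector f u a b)) (differential f u (axis m 1))
    = lorentz (hessian f u a b) (differential f u (axis m 1))" for m
  proof -
    have "differential f u (christoffel_vector f u a b)
      = (\<Sum>k\<in>UNIV. christoffel_vector f u a b $ k *\<^sub>R differential f u (axis k 1))"
      by (subst vec2_expansion) (simp add: sum_2 linear_add[OF linear_differential] linear_cmul[OF linear_differential])
    then have "lorentz (differential f u (christoffel_vector f u a b)) (differential f u (axis m 1))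
      = (\<Sum>k\<in>UNIV. christoffel_vector f u a b $ k * gram f u $ k $ m)"
      by (simp add: lorentz_sum_left gram_def induced_metric_def)
    also have "\<dots> = (\<Sum>i\<in>UNIV. \<Sum>j\<in>UNIV. a $ i * b $ j * (\<Sum>k\<in>UNIV. christoffel f u k i j * gram f u $ k $ m))"
      unfolding christoffel_vector_def by (simp add: sum_2 algebra_simps)
    also have "\<dots> = lorentz (\<Sum>i\<in>UNIV. \<Sum>j\<in>UNIV. (a $ i * b $ j) *\<^sub>R hessian f u (axis i 1) (axis j 1)) (differential f u (axis m 1))"
      unfolding christoffel_lowered[OF assms] by (simp add: sum_2 algebra_simps)
    also have "(\<Sum>i\<in>UNIV. \<Sum>j\<in>UNIV. (a $ i * b $ j) *\<^sub>R hessian f u (axis i 1) (axis j 1)) = hessian f u a b"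
      using arg_cong2[OF vec2_expansion[of a] vec2_expansion[of b], of "hessian f u"]
      by (simp add: sum_2 linear_add[OF linear_hessian_left[OF f S u]] linear_cmul[OF linear_hessian_left[OF f S u]]
          linear_add[OF linear_hessian_right[OF f S u]] linear_cmul[OF linear_hessian_right[OF f S u]] algebra_simps)
    finally show ?thesis .
  qed
  show ?thesis
    by (subst (1 2) vec2_expansion[of c])
      (simp add: linear_add[OF linear_differential] linear_cmul[OF linear_differential] m)
qed

lemma levi_civita_is_projection:
  assumes "nondegenerate f u" "smooth_on Y S"
  shows "lorentz (differential f u (levi_civita f X Y u)) (differential f u c)
    = lorentz (differential (\<lambda>x. differential f x (Y x)) u (X u)) (differential f u c)"
  unfolding levi_civita_eq derivative_along_field[OF f S u assms(2)]
  by (simp add: linear_add[OF linear_differential] christoffel_vector_is_projection[OF assms(1)])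

end

text \<open>Both the second fundamental form (for \<open>s = f\<close>) and the summands of the bitension field (for \<open>s\<close> the tension field) are of
this form. Being bilinear in the values of the fields, it allows traces to be moved from one frame to another.\<close>

definition covariant_hessian ::
    "(real^2 \<Rightarrow> complex^2) \<Rightarrow> (real^2 \<Rightarrow> complex^2) \<Rightarrow> real^2 \<Rightarrow> real^2 \<Rightarrow> real^2 \<Rightarrow> complex^2" where
  "covariant_hessian f s u a b = hessian s u a b - differential s u (christoffel_vector f u a b)"

lemma covariant_hessian_along_fields:
  assumes "smooth_on s S" "open S" "u \<in> S" "smooth_on Y S"
  shows "differential (\<lambda>x. differential s x (Y x)) u (X u) - differential s u (levi_civita f X Y u)
    = covariant_hessian f s u (X u) (Y u)"
  unfolding covariant_hessian_def levi_civita_eq derivative_along_field[OF assms]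
  by (simp add: linear_add[OF linear_differential[OF assms(1-3)]])

lemma bilinear_covariant_hessian:
  assumes "smooth_on s S" "open S" "u \<in> S"
  shows "bilinear (covariant_hessian f s u)"
proof -
  note l = linear_differential[OF assms] linear_hessian_left[OF assms] linear_hessian_right[OF assms]
    bilinear_ladd[OF bilinear_christoffel_vector] bilinear_radd[OF bilinear_christoffel_vector]
    bilinear_lmul[OF bilinear_christoffel_vector] bilinear_rmul[OF bilinear_christoffel_vector]
  show ?thesis
    unfolding bilinear_def covariant_hessian_def
    by (auto intro!: linearI simp: linear_add[OF l(1)] linear_add[OF l(2)] linear_add[OF l(3)]
      linear_cmul[OF l(1)] linear_cmul[OF l(2)] linear_cmul[OF l(3)] l(4-) algebra_simps)
qed

lemma christoffel_vector_commute:
  assumes "smooth_on f S" "open S" "u \<in> S"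
  shows "christoffel_vector f u a b = christoffel_vector f u b a"
proof -
  have "christoffel f u k i j = christoffel f u k j i" for k i j
    unfolding christoffel_def by (simp add: gram_commute[OF assms, of i j] derivative_gram[OF assms]
      lorentz_commute[of "differential f u _"] algebra_simps)
  then show ?thesis
    unfolding christoffel_vector_def vec_eq_iff by (simp add: sum_2 algebra_simps)
qed

lemma covariant_hessian_commute:
  assumes "smooth_on f S" "smooth_on s S" "open S" "u \<in> S"
  shows "covariant_hessian f s u a b = covariant_hessian f s u b a"
  unfolding covariant_hessian_def
  by (simp add: hessian_commute[OF assms(2-4), of a] christoffel_vector_commute[OF assms(1,3,4), of a])

section \<open>Null frames adapted to the mean curvature\<close>

definition along :: "('a \<Rightarrow> 'a) \<Rightarrow> ('a::real_normed_vector \<Rightarrow> 'b::real_normed_vector) \<Rightarrow> 'a \<Rightarrow> 'b" where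
  "along X s u = frechet_derivative s (at u) (X u)"

lemma smooth_on_along:
  fixes s :: "'a::euclidean_space \<Rightarrow> 'b::real_normed_vector"
  shows "open S \<Longrightarrow> smooth_on s S \<Longrightarrow> smooth_on X S \<Longrightarrow> smooth_on (along X s) S"
  unfolding along_def by (rule smooth_on_frechet_derivative)

lemma along_cong_open:
  assumes "open S" "u \<in> S" "\<And>x. x \<in> S \<Longrightarrow> g x = h x"
  shows "along X g u = along X h u"
  unfolding along_def by (simp add: frechet_derivative_cong_open[OF assms])

lemma along_bilinear:
  assumes "bounded_bilinear B" "smooth_on g S" "smooth_on h S" "u \<in> S"
  shows "along X (\<lambda>x. B (g x) (h x)) u = B (g u) (along X h u) + B (along X g u) (h u)"
  unfolding along_def using assms by (intro frechet_derivative_bilinear smooth_on_imp_differentiable)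

lemmas along_scaleR = along_bilinear[OF bounded_bilinear_scaleR]
lemmas along_lorentz = along_bilinear[OF bounded_bilinear_lorentz]

lemma along_J:
  assumes "smooth_on g S" "u \<in> S"
  shows "along X (\<lambda>x. J (g x)) u = J (along X g u)"
  unfolding along_def
  using assms by (intro frechet_derivative_bounded_linear bounded_linear_J smooth_on_imp_differentiable)

lemma along_add:
  assumes "smooth_on g S" "smooth_on h S" "u \<in> S"
  shows "along X (\<lambda>x. g x + h x) u = along X g u + along X h u"
  unfolding along_def
  using smooth_on_has_derivative[OF assms(1,3)] smooth_on_has_derivative[OF assms(2,3)]
  by (subst frechet_derivative_eq[OF has_derivative_add]) auto

lemma along_diff:
  assumes "smooth_on g S" "smooth_on h S" "u \<in> S"
  shows "along X (\<lambda>x. g x - h x) u = along X g u - along X h u"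
  unfolding along_def
  using smooth_on_has_derivative[OF assms(1,3)] smooth_on_has_derivative[OF assms(2,3)]
  by (subst frechet_derivative_eq[OF has_derivative_diff]) auto

text \<open>Flatness of the ambient space; the second derivatives of \<open>s\<close> cancel and only the bracket of the fields remains.\<close>

lemma along_commutator:
  fixes s :: "real^2 \<Rightarrow> 'b::euclidean_space"
  assumes "smooth_on s S" "open S" "u \<in> S" "smooth_on X S" "smooth_on Y S"
  shows "along X (along Y s) u - along Y (along X s) u
    = frechet_derivative s (at u) (along X Y u - along Y X u)"
proof -
  have "linear (frechet_derivative s (at u))"
    using assms by (intro linear_frechet_derivative smooth_on_imp_differentiable)
  then show ?thesis
    unfolding along_def derivative_along_field[OF assms(1-3,4)] derivative_along_field[OF assms(1-3,5)]
    using hessian_commute[OF assms(1-3), of "X u" "Y u"] by (simp add: linear_diff)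
qed

lemmas smooth_on_J = smooth_on_bounded_linear[OF bounded_linear_J]
lemmas smooth_on_lorentz = smooth_on_bounded_bilinear[OF bounded_bilinear_lorentz]

text \<open>A null frame of a Lagrangian surface, scaled so that the normal part of the derivative of \<open>e2\<close> along \<open>e1\<close>
is \<open>J e1\<close>. As the trace of a form is \<open>- 2\<close> times its value on a null pair with product \<open>- 1\<close>, this says that the mean curvature vector is
\<open>- J e1\<close>. The tangential part is left open here; it is determined by the integrability conditions.\<close>

locale mean_null_frame =
  fixes f :: "real^2 \<Rightarrow> complex^2" and S :: "(real^2) set" and X1 X2 :: "real^2 \<Rightarrow> real^2"
  assumes open_S: "open S"
    and smooth_f: "smooth_on f S" and smooth_X1: "smooth_on X1 S" and smooth_X2: "smooth_on X2 S"
    and inj: "u \<in> S \<Longrightarrow> inj (differential f u)"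
    and isotropic: "u \<in> S \<Longrightarrow> lorentz (differential f u v) (J (differential f u w)) = 0"
    and null1: "u \<in> S \<Longrightarrow> lorentz (along X1 f u) (along X1 f u) = 0"
    and null2: "u \<in> S \<Longrightarrow> lorentz (along X2 f u) (along X2 f u) = 0"
    and pairing: "u \<in> S \<Longrightarrow> lorentz (along X1 f u) (along X2 f u) = - 1"
    and mean1: "u \<in> S \<Longrightarrow> lorentz (along X1 (along X2 f) u) (J (along X1 f u)) = 0"
    and mean2: "u \<in> S \<Longrightarrow> lorentz (along X1 (along X2 f) u) (J (along X2 f u)) = - 1"
begin

abbreviation "e1 \<equiv> along X1 f"
abbreviation "e2 \<equiv> along X2 f"
abbreviation "D1 \<equiv> along X1"
abbreviation "D2 \<equiv> along X2"

text \<open>The unknowns left by the symmetries: \<open>w1, w2\<close> are the connection form of the null frame, \<open>k1, k2\<close> the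
components of the second fundamental form on the two null directions.\<close>

definition "w1 u = - lorentz (along X1 e1 u) (e2 u)"
definition "w2 u = - lorentz (along X2 e1 u) (e2 u)"
definition "k1 u = - lorentz (along X1 e1 u) (J (e1 u))"
definition "k2 u = - lorentz (along X2 e2 u) (J (e2 u))"

lemma smooth_frame: "smooth_on e1 S" "smooth_on e2 S"
  by (auto intro!: smooth_on_along open_S smooth_f smooth_X1 smooth_X2)

lemma smooth_coefficients: "smooth_on w1 S" "smooth_on w2 S" "smooth_on k1 S" "smooth_on k2 S"
  unfolding w1_def w2_def k1_def k2_def
  by (intro smooth_on_minus smooth_on_lorentz smooth_on_along smooth_on_J open_S smooth_f smooth_X1 smooth_X2)+

lemma smooth_J_frame: "smooth_on (\<lambda>u. J (e1 u)) S" "smooth_on (\<lambda>u. J (e2 u)) S"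
  by (intro smooth_on_J open_S smooth_frame)+

lemma isotropic_frame:
  "u \<in> S \<Longrightarrow> lorentz (along X f u) (J (along Y f u)) = 0"
  unfolding along_def by (rule isotropic)

lemma frame_expansion:
  assumes "u \<in> S"
  shows "w = - lorentz w (e2 u) *\<^sub>R e1 u - lorentz w (e1 u) *\<^sub>R e2 u
    - lorentz w (J (e2 u)) *\<^sub>R J (e1 u) - lorentz w (J (e1 u)) *\<^sub>R J (e2 u)"
  by (rule null_pair_expansion) (use assms null1 null2 pairing isotropic_frame in auto)

lemma constant_lorentz_along:
  assumes "u \<in> S" "smooth_on g S" "smooth_on h S" "\<And>x. x \<in> S \<Longrightarrow> lorentz (g x) (h x) = c"
  shows "lorentz (along X g u) (h u) = - lorentz (g u) (along X h u)"
proof -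
  have "along X (\<lambda>x. lorentz (g x) (h x)) u = along X (\<lambda>x. c) u"
    by (rule along_cong_open[OF open_S assms(1,4)])
  then show ?thesis
    unfolding along_lorentz[OF assms(2,3,1)] by (simp add: along_def)
qed

text \<open>The cubic form \<open>\<langle>h(X, Y), J Z\<rangle>\<close> of a Lagrangian surface is symmetric in \<open>Y\<close> and \<open>Z\<close>: differentiate \<open>\<langle>df Y, J df Z\<rangle> = 0\<close>.\<close>

lemma second_fundamental_symmetric:
  assumes "u \<in> S" "smooth_on Y S" "smooth_on Z S"
  shows "lorentz (along X (along Y f) u) (J (along Z f u)) = lorentz (along X (along Z f) u) (J (along Y f u))"
proof -
  have sm: "smooth_on (along Y f) S" "smooth_on (along Z f) S"
    using assms by (auto intro!: smooth_on_along open_S smooth_f)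
  have "lorentz (along X (along Y f) u) (J (along Z f u)) = - lorentz (along Y f u) (J (along X (along Z f) u))"
    using constant_lorentz_along[OF assms(1) sm(1) smooth_on_J[OF open_S sm(2)] isotropic_frame, of X]
      along_J[OF sm(2) assms(1), of X] by simp
  then show ?thesis
    using lorentz_J_left[of "along Y f u"] lorentz_commute by metis
qed

lemma frame_torsion_free:
  assumes "u \<in> S"
  shows "D1 e2 u - D2 e1 u = differential f u (D1 X2 u - D2 X1 u)"
  by (rule along_commutator[OF smooth_f open_S assms smooth_X1 smooth_X2])

text \<open>Each derivative is expanded in the frame. The tangential coefficients are related since the frame has constant
inner products; the normal ones agree under permutation of the three indices, and two of the four independent
ones are prescribed by the mean curvature.\<close>

lemma structure_equations:
  assumes u: "u \<in> S"
  shows "D1 e1 u = w1 u *\<^sub>R e1 u + k1 u *\<^sub>R J (e2 u)"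
    and "D1 e2 u = J (e1 u) - w1 u *\<^sub>R e2 u"
    and "D2 e1 u = w2 u *\<^sub>R e1 u + J (e1 u)"
    and "D2 e2 u = k2 u *\<^sub>R J (e1 u) + J (e2 u) - w2 u *\<^sub>R e2 u"
proof -
  have norms: "lorentz (along X e1 u) (e1 u) = 0" "lorentz (along X e2 u) (e2 u) = 0"
    "lorentz (along X e2 u) (e1 u) = - lorentz (along X e1 u) (e2 u)" for X
    using constant_lorentz_along[OF u smooth_frame(1,1) null1, of X]
      constant_lorentz_along[OF u smooth_frame(2,2) null2, of X]
      constant_lorentz_along[OF u smooth_frame(1,2) pairing, of X]
    by (auto simp: lorentz_commute)
  have exch: "lorentz (D2 e1 u) (J (along Z f u)) = lorentz (D1 e2 u) (J (along Z f u))" for Z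
    using frame_torsion_free[OF u] isotropic[OF u, of "D1 X2 u - D2 X1 u" "Z u"]
    by (metis along_def lorentz_simps(3) right_minus_eq)
  note sym = second_fundamental_symmetric[OF u]
  have c: "lorentz (D1 e1 u) (J (e2 u)) = 0" "lorentz (D2 e2 u) (J (e1 u)) = - 1"
    using sym[OF smooth_X1 smooth_X2, of X1] sym[OF smooth_X2 smooth_X1, of X2]
      exch[of X2] mean1[OF u] mean2[OF u] by auto
  show "D1 e1 u = w1 u *\<^sub>R e1 u + k1 u *\<^sub>R J (e2 u)"
    using frame_expansion[OF u, of "D1 e1 u"] norms[of X1] c by (simp add: w1_def k1_def)
  show "D1 e2 u = J (e1 u) - w1 u *\<^sub>R e2 u"
    using frame_expansion[OF u, of "D1 e2 u"] norms[of X1] mean1[OF u] mean2[OF u] by (simp add: w1_def)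
  show "D2 e1 u = w2 u *\<^sub>R e1 u + J (e1 u)"
    using frame_expansion[OF u, of "D2 e1 u"] norms[of X2] exch[of X1] exch[of X2] mean1[OF u] mean2[OF u]
    by (simp add: w2_def)
  show "D2 e2 u = k2 u *\<^sub>R J (e1 u) + J (e2 u) - w2 u *\<^sub>R e2 u"
    by (rule trans[OF frame_expansion[OF u]]) (simp add: norms c w2_def k2_def)
qed

text \<open>The bracket of the frame fields is read off from the structure equations, because \<open>differential f\<close> is injective and maps it to
\<open>D1 e2 - D2 e1\<close>.\<close>

lemma frame_commutator:
  fixes s :: "real^2 \<Rightarrow> complex^2"
  assumes u: "u \<in> S" and s: "smooth_on s S"
  shows "D1 (D2 s) u - D2 (D1 s) u = - w2 u *\<^sub>R D1 s u - w1 u *\<^sub>R D2 s u"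
proof -
  have lin: "linear (differential g u)" if "smooth_on g S" for g :: "real^2 \<Rightarrow> complex^2"
    using that u by (intro linear_frechet_derivative smooth_on_imp_differentiable)
  have "differential f u (D1 X2 u - D2 X1 u) = - w2 u *\<^sub>R e1 u - w1 u *\<^sub>R e2 u"
    unfolding frame_torsion_free[OF u, symmetric] structure_equations[OF u] by simp
  also have "\<dots> = differential f u (- w2 u *\<^sub>R X1 u - w1 u *\<^sub>R X2 u)"
    by (simp add: linear_diff[OF lin[OF smooth_f]] linear_cmul[OF lin[OF smooth_f]] linear_neg[OF lin[OF smooth_f]] along_def)
  finally have "D1 X2 u - D2 X1 u = - w2 u *\<^sub>R X1 u - w1 u *\<^sub>R X2 u"
    using inj[OF u] by (simp add: inj_eq)
  then show ?thesis
    unfolding along_commutator[OF s open_S u smooth_X1 smooth_X2]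
    by (simp add: linear_diff[OF lin[OF s]] linear_cmul[OF lin[OF s]] linear_neg[OF lin[OF s]] along_def)
qed

lemma frame_coefficients_eq:
  assumes u: "u \<in> S" and "a1 *\<^sub>R e1 u + b1 *\<^sub>R e2 u + c1 *\<^sub>R J (e1 u) + d1 *\<^sub>R J (e2 u) =
    a2 *\<^sub>R e1 u + b2 *\<^sub>R e2 u + c2 *\<^sub>R J (e1 u) + d2 *\<^sub>R J (e2 u)"
  shows "a1 = a2" "b1 = b2" "c1 = c2" "d1 = d2"
proof -
  have n: "lorentz (e1 u) (e1 u) = 0" "lorentz (e2 u) (e2 u) = 0" "lorentz (e1 u) (e2 u) = - 1"
    "lorentz (e2 u) (e1 u) = - 1" "lorentz (e1 u) (J (e2 u)) = 0" "lorentz (e2 u) (J (e1 u)) = 0"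
    "lorentz (J (e1 u)) (e2 u) = 0" "lorentz (J (e2 u)) (e1 u) = 0"
    using null1[OF u] null2[OF u] pairing[OF u] isotropic_frame[OF u] by (auto simp: lorentz_commute)
  note c = arg_cong[OF assms(2), of "\<lambda>z. lorentz z w" for w]
  show "a1 = a2" "b1 = b2" "c1 = c2" "d1 = d2"
    using c[of "e2 u"] c[of "e1 u"] c[of "J (e2 u)"] c[of "J (e1 u)"] n by auto
qed

lemma derivatives_of_structure_equations:
  assumes u: "u \<in> S"
  shows "along X (D1 e1) u = along X w1 u *\<^sub>R e1 u + w1 u *\<^sub>R along X e1 u + along X k1 u *\<^sub>R J (e2 u) + k1 u *\<^sub>R J (along X e2 u)"
    and "along X (D1 e2) u = - along X w1 u *\<^sub>R e2 u - w1 u *\<^sub>R along X e2 u + J (along X e1 u)"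
    and "along X (D2 e1) u = along X w2 u *\<^sub>R e1 u + w2 u *\<^sub>R along X e1 u + J (along X e1 u)"
    and "along X (D2 e2) u = - along X w2 u *\<^sub>R e2 u - w2 u *\<^sub>R along X e2 u
      + along X k2 u *\<^sub>R J (e1 u) + k2 u *\<^sub>R J (along X e1 u) + J (along X e2 u)"
proof -
  note sm = smooth_frame smooth_J_frame smooth_coefficients
  note a = along_add[OF _ _ u] along_diff[OF _ _ u] along_scaleR[OF _ _ u] along_J[OF _ u]
  note S = smooth_on_add[OF open_S] smooth_on_diff[OF open_S] smooth_on_scaleR[OF open_S] sm
  have "along X (D1 e1) u = along X (\<lambda>x. w1 x *\<^sub>R e1 x + k1 x *\<^sub>R J (e2 x)) u"
    by (rule along_cong_open[OF open_S u]) (rule structure_equations)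
  then show "along X (D1 e1) u = along X w1 u *\<^sub>R e1 u + w1 u *\<^sub>R along X e1 u + along X k1 u *\<^sub>R J (e2 u) + k1 u *\<^sub>R J (along X e2 u)"
    by (simp add: a S)
  have "along X (D1 e2) u = along X (\<lambda>x. J (e1 x) - w1 x *\<^sub>R e2 x) u"
    by (rule along_cong_open[OF open_S u]) (rule structure_equations)
  then show "along X (D1 e2) u = - along X w1 u *\<^sub>R e2 u - w1 u *\<^sub>R along X e2 u + J (along X e1 u)"
    by (simp add: a S)
  have "along X (D2 e1) u = along X (\<lambda>x. w2 x *\<^sub>R e1 x + J (e1 x)) u"
    by (rule along_cong_open[OF open_S u]) (rule structure_equations)
  then show "along X (D2 e1) u = along X w2 u *\<^sub>R e1 u + w2 u *\<^sub>R along X e1 u + J (along X e1 u)"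
    by (simp add: a S)
  have "along X (D2 e2) u = along X (\<lambda>x. k2 x *\<^sub>R J (e1 x) + J (e2 x) - w2 x *\<^sub>R e2 x) u"
    by (rule along_cong_open[OF open_S u]) (rule structure_equations)
  then show "along X (D2 e2) u = - along X w2 u *\<^sub>R e2 u - w2 u *\<^sub>R along X e2 u
      + along X k2 u *\<^sub>R J (e1 u) + k2 u *\<^sub>R J (along X e1 u) + J (along X e2 u)"
    by (simp add: a S)
qed

text \<open>This is the \<open>J e1\<close> component of the integrability condition for \<open>e1\<close>: the contributions of
\<open>D1 D2 e1\<close> and \<open>D2 D1 e1\<close> cancel, and the bracket term contributes \<open>- w1\<close>.\<close>

lemma w1_zero:
  assumes u: "u \<in> S"
  shows "w1 u = 0"
proof -
  note st = structure_equations[OF u] derivatives_of_structure_equations[OF u]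
  have "D1 (D2 e1) u - D2 (D1 e1) u = - w2 u *\<^sub>R D1 e1 u - w1 u *\<^sub>R D2 e1 u"
    by (rule frame_commutator[OF u smooth_frame(1)])
  then have "(D1 w2 u - D2 w1 u + k1 u * k2 u) *\<^sub>R e1 u + 0 *\<^sub>R e2 u + 0 *\<^sub>R J (e1 u) + (w2 u * k1 u + w2 u * k1 u - D2 k1 u) *\<^sub>R J (e2 u)
    = (- (w1 u * w2 u) - w1 u * w2 u) *\<^sub>R e1 u + 0 *\<^sub>R e2 u + (- w1 u) *\<^sub>R J (e1 u) + (- w2 u * k1 u) *\<^sub>R J (e2 u)"
    unfolding st by (simp add: vec_eq_iff scaleR_conv_of_real algebra_simps)
  from frame_coefficients_eq(3)[OF u this] show ?thesis
    by simp
qed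

text \<open>The \<open>e2\<close> and \<open>J e1\<close> components of the integrability condition for \<open>e2\<close>, after \<open>w1\<close> and its derivatives have
dropped out.\<close>

lemma compatibility_equations:
  assumes u: "u \<in> S"
  shows "D1 w2 u = - k1 u * k2 u" "D1 k2 u = w2 u"
proof -
  note st = structure_equations[OF u] derivatives_of_structure_equations[OF u]
  have "D1 (D2 e2) u - D2 (D1 e2) u = - w2 u *\<^sub>R D1 e2 u - w1 u *\<^sub>R D2 e2 u"
    by (rule frame_commutator[OF u smooth_frame(2)])
  moreover have "D2 w1 u = 0"
    using along_cong_open[OF open_S u, of w1 "\<lambda>_. 0" X2] w1_zero by (simp add: along_def)
  ultimately have "0 *\<^sub>R e1 u + (- D1 w2 u - k1 u * k2 u) *\<^sub>R e2 u + (D1 k2 u - w2 u - w2 u) *\<^sub>R J (e1 u) + 0 *\<^sub>R J (e2 u)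
    = 0 *\<^sub>R e1 u + 0 *\<^sub>R e2 u + (- w2 u) *\<^sub>R J (e1 u) + 0 *\<^sub>R J (e2 u)"
    unfolding st w1_zero[OF u] by (simp add: vec_eq_iff scaleR_conv_of_real algebra_simps)
  from frame_coefficients_eq(2,3)[OF u this] show "D1 w2 u = - k1 u * k2 u" "D1 k2 u = w2 u"
    by auto
qed

lemma along_along_e1:
  assumes u: "u \<in> S"
  shows "D1 (D2 e1) u = - (k1 u * k2 u) *\<^sub>R e1 u - k1 u *\<^sub>R e2 u + (w2 u * k1 u) *\<^sub>R J (e2 u)"
  unfolding derivatives_of_structure_equations[OF u] structure_equations[OF u] compatibility_equations[OF u] w1_zero[OF u]
  by (simp add: algebra_simps)

text \<open>The vector in the hypothesis is, up to \<open>4 J\<close>, the bitension field. It is a multiple of \<open>k1\<close>, which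
excludes zeros of \<open>k1\<close>, and its square norm is \<open>- 2 k1\<^sup>2 k2\<close>, which forces \<open>k2\<close> to vanish. Since this holds
on an open set, \<open>w2 = D1 k2\<close> vanishes too.\<close>

lemma lightlike_imp_flat:
  assumes ll: "\<And>u. u \<in> S \<Longrightarrow> lightlike (D1 (D2 e1) u)" and u: "u \<in> S"
  shows "k1 u \<noteq> 0" "k2 u = 0" "w2 u = 0"
proof -
  have *: "k1 x \<noteq> 0 \<and> k2 x = 0" if x: "x \<in> S" for x
  proof -
    have n: "lorentz (e1 x) (e1 x) = 0" "lorentz (e2 x) (e2 x) = 0" "lorentz (e1 x) (e2 x) = - 1"
      "lorentz (e2 x) (e1 x) = - 1" "lorentz (e1 x) (J (e2 x)) = 0" "lorentz (J (e2 x)) (e1 x) = 0"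
      using null1[OF x] null2[OF x] pairing[OF x] isotropic_frame[OF x] by (auto simp: lorentz_commute)
    have "lorentz (D1 (D2 e1) x) (D1 (D2 e1) x) = - 2 * (k1 x * k1 x * k2 x)"
      unfolding along_along_e1[OF x] by (simp add: n)
    moreover have "D1 (D2 e1) x = 0" if "k1 x = 0"
      unfolding along_along_e1[OF x] using that by simp
    ultimately show ?thesis
      using ll[OF x] by (auto simp: lightlike_def)
  qed
  then show "k1 u \<noteq> 0" "k2 u = 0"
    using u by auto
  have "D1 k2 u = along X1 (\<lambda>_. 0) u"
    by (rule along_cong_open[OF open_S u]) (use * in auto)
  then show "w2 u = 0"
    using compatibility_equations(2)[OF u] by (simp add: along_def)
qed

end

section \<open>From orthonormal frames to the adapted null frame\<close>

lemma bilinear_real2_expansion: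
  fixes x y :: "real^2"
  assumes "bilinear B"
  shows "B x y = (x$1 * y$1) *\<^sub>R B (axis 1 1) (axis 1 1) + (x$1 * y$2) *\<^sub>R B (axis 1 1) (axis 2 1)
    + (x$2 * y$1) *\<^sub>R B (axis 2 1) (axis 1 1) + (x$2 * y$2) *\<^sub>R B (axis 2 1) (axis 2 1)"
  by (subst arg_cong2[OF vec2_expansion[of x] vec2_expansion[of y], of B])
    (simp add: bilinear_ladd[OF assms] bilinear_radd[OF assms] bilinear_lmul[OF assms] bilinear_rmul[OF assms]
      algebra_simps)

text \<open>The Gram determinant of a pair is the Gram determinant of the standard basis times the square of the determinant of the
pair; an orthonormal pair is therefore a basis, even for an indefinite form.\<close>

lemma orthogonal_to_orthonormal_pair_imp_zero:
  fixes B :: "real^2 \<Rightarrow> real^2 \<Rightarrow> real"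
  assumes B: "bilinear B" and sym: "\<And>x y. B x y = B y x"
    and a: "\<bar>B a a\<bar> = 1" and b: "\<bar>B b b\<bar> = 1" and ab: "B a b = 0"
    and r: "B r a = 0" "B r b = 0"
  shows "B r w = 0"
proof -
  define d where "d = a$1 * b$2 - a$2 * b$1"
  define D where "D = B (axis 1 1) (axis 1 1) * B (axis 2 1) (axis 2 1) - B (axis 1 1) (axis 2 1) * B (axis 1 1) (axis 2 1)"
  have "B a a * B b b - B a b * B a b = d * d * D"
    unfolding d_def D_def
    by (subst (1 2 3 4) bilinear_real2_expansion[OF B])
      (simp add: sym[of "axis 2 1" "axis 1 1"] algebra_simps)
  then have "d \<noteq> 0"
    using a b ab by auto
  have "d *\<^sub>R w = (w$1 * b$2 - w$2 * b$1) *\<^sub>R a + (a$1 * w$2 - a$2 * w$1) *\<^sub>R b"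
    by (simp add: vec_eq_iff forall_2 d_def algebra_simps)
  then have "B r (d *\<^sub>R w) = 0"
    by (simp add: bilinear_radd[OF B] bilinear_rmul[OF B] r)
  then show ?thesis
    using \<open>d \<noteq> 0\<close> by (simp add: bilinear_rmul[OF B])
qed

text \<open>Traces computed in a null pair. From one null vector \<open>p a + q b\<close> with coefficients in an orthonormal pair the complementary
null vector is obtained by formulas that are smooth in the nonzero numbers \<open>p\<close> and \<open>q\<close>.\<close>

lemma trace_null_pair:
  fixes B :: "'a::real_vector \<Rightarrow> 'a \<Rightarrow> 'b::real_vector" and \<epsilon>1 \<epsilon>2 p q :: real
  assumes B: "bilinear B" and sym: "B b a = B a b"
    and sgn: "\<bar>\<epsilon>1\<bar> = 1" "\<bar>\<epsilon>2\<bar> = 1" and pq: "\<epsilon>1 * (p * p) + \<epsilon>2 * (q * q) = 0" "p \<noteq> 0" "q \<noteq> 0"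
  shows "B (p *\<^sub>R a + q *\<^sub>R b) ((- \<epsilon>1 / (2 * p)) *\<^sub>R a + (- \<epsilon>2 / (2 * q)) *\<^sub>R b)
    = - (1/2) *\<^sub>R (\<epsilon>1 *\<^sub>R B a a + \<epsilon>2 *\<^sub>R B b b)"
proof -
  define r t where "r = - \<epsilon>1 / (2 * p)" and "t = - \<epsilon>2 / (2 * q)"
  have sq: "\<epsilon>1 * \<epsilon>1 = 1" "\<epsilon>2 * \<epsilon>2 = 1"
    using sgn by (auto simp: abs_if split: if_splits)
  have "\<epsilon>2 * (p * p) + \<epsilon>1 * (q * q) = \<epsilon>2 * (\<epsilon>1 * \<epsilon>1) * (p * p) + \<epsilon>1 * (\<epsilon>2 * \<epsilon>2) * (q * q)"
    by (simp add: sq)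
  also have "\<dots> = \<epsilon>1 * \<epsilon>2 * (\<epsilon>1 * (p * p) + \<epsilon>2 * (q * q))"
    by (simp add: algebra_simps)
  finally have "\<epsilon>2 * (p * p) + \<epsilon>1 * (q * q) = 0"
    using pq(1) by simp
  then have mixed: "p * t + q * r = 0"
    using pq(2,3) unfolding r_def t_def by (simp add: field_simps)
  have "B (p *\<^sub>R a + q *\<^sub>R b) (r *\<^sub>R a + t *\<^sub>R b)
    = (p * r) *\<^sub>R B a a + (p * t + q * r) *\<^sub>R B a b + (q * t) *\<^sub>R B b b"
    by (simp add: bilinear_ladd[OF B] bilinear_radd[OF B] bilinear_lmul[OF B] bilinear_rmul[OF B] sym algebra_simps)
  moreover have "p * r = - \<epsilon>1 / 2" "q * t = - \<epsilon>2 / 2"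
    using pq(2,3) by (simp_all add: r_def t_def)
  ultimately have "B (p *\<^sub>R a + q *\<^sub>R b) (r *\<^sub>R a + t *\<^sub>R b) = - (1/2) *\<^sub>R (\<epsilon>1 *\<^sub>R B a a + \<epsilon>2 *\<^sub>R B b b)"
    by (simp only: mixed) (simp add: algebra_simps)
  then show ?thesis
    by (simp only: r_def t_def)
qed

lemma bilinear_induced_metric:
  assumes "smooth_on f S" "open S" "u \<in> S"
  shows "bilinear (induced_metric f u)"
  unfolding bilinear_def induced_metric_def
  by (auto intro!: linearI simp: linear_add[OF linear_differential[OF assms]] linear_cmul[OF linear_differential[OF assms]])

lemma induced_metric_commute: "induced_metric f u v w = induced_metric f u w v"
  by (simp add: induced_metric_def lorentz_commute)

lemma smooth_on_induced_metric:
  assumes "open S" "smooth_on f S" "smooth_on X S" "smooth_on Y S"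
  shows "smooth_on (\<lambda>u. induced_metric f u (X u) (Y u)) S"
  unfolding induced_metric_def
  by (intro smooth_on_lorentz smooth_on_frechet_derivative assms)

text \<open>Gram-Schmidt for an indefinite metric: it starts with a constant vector \<open>a\<close> of nonzero length at \<open>u0\<close>. The second vector \<open>b\<close> is
the rotated covector \<open>\<langle>a, \<cdot>\<rangle>\<close>, which is orthogonal to \<open>a\<close> without any division. The neighbourhood is where the
lengths keep their signs.\<close>

lemma orthonormal_frame_exists:
  assumes f: "smooth_on f S" and S: "open S" and u0: "u0 \<in> S" and nd: "nondegenerate f u0"
  obtains V e where "open V" "u0 \<in> V" "V \<subseteq> S" "orthonormal_frame f V e"
proof -
  let ?g = "induced_metric f"
  note B = bilinear_induced_metric[OF f S]
  obtain a where a: "?g u0 a a \<noteq> 0"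
  proof (rule ccontr)
    assume "\<not> thesis"
    then have z: "?g u0 v v = 0" for v
      using that by blast
    have "?g u0 v w = 0" for v w
      using z[of "v + w"] z[of v] z[of w] induced_metric_commute[of f u0 w v]
      by (simp add: bilinear_ladd[OF B[OF u0]] bilinear_radd[OF B[OF u0]])
    then have "(axis 1 1 :: real^2) = 0"
      using nd unfolding nondegenerate_def by blast
    then show False
      by (simp add: axis_eq_0_iff)
  qed
  define b where "b = (\<lambda>u. (- ?g u a (axis 2 1)) *\<^sub>R axis 1 1 + ?g u a (axis 1 1) *\<^sub>R (axis 2 1 :: real^2))"
  have ab: "?g u a (b u) = 0" if "u \<in> S" for u
    unfolding b_def by (simp add: bilinear_rsub[OF B[OF that]] bilinear_rmul[OF B[OF that]])
  have b0: "?g u0 (b u0) (b u0) \<noteq> 0"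
  proof
    assume bb: "?g u0 (b u0) (b u0) = 0"
    have comp: "b u0 $ 1 = - ?g u0 a (axis 2 1)" "b u0 $ 2 = ?g u0 a (axis 1 1)"
      by (simp_all add: b_def axis_def)
    have ga: "?g u0 a v = v $ 1 * b u0 $ 2 - v $ 2 * b u0 $ 1" for v
      by (subst (1) vec2_expansion[of v]) (simp add: comp bilinear_radd[OF B[OF u0]] bilinear_rmul[OF B[OF u0]])
    define d where "d = a $ 1 * b u0 $ 2 - a $ 2 * b u0 $ 1"
    have "d \<noteq> 0"
      using ga[of a] a by (simp add: d_def)
    have "?g u0 (b u0) w = 0" for w
    proof -
      have "d *\<^sub>R w = (w$1 * b u0 $ 2 - w$2 * b u0 $ 1) *\<^sub>R a + (a$1 * w$2 - a$2 * w$1) *\<^sub>R b u0"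
        by (simp add: vec_eq_iff forall_2 d_def algebra_simps)
      then have "?g u0 (b u0) (d *\<^sub>R w) = 0"
        using ab[OF u0] bb by (simp add: bilinear_radd[OF B[OF u0]] bilinear_rmul[OF B[OF u0]] induced_metric_commute[of f u0 "b u0" a])
      then show ?thesis
        using \<open>d \<noteq> 0\<close> by (simp add: bilinear_rmul[OF B[OF u0]])
    qed
    then have "b u0 = 0"
      using nd unfolding nondegenerate_def by blast
    then show False
      using \<open>d \<noteq> 0\<close> by (simp add: d_def)
  qed
  define ga gb where "ga = (\<lambda>u. sgn (?g u0 a a) * ?g u a a)" and "gb = (\<lambda>u. sgn (?g u0 (b u0) (b u0)) * ?g u (b u) (b u))"
  have sm_b: "smooth_on b S"
    unfolding b_def by (intro smooth_on_add smooth_on_scaleR smooth_on_minus smooth_on_induced_metric smooth_on_const S f)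
  have sm: "smooth_on ga S" "smooth_on gb S"
    unfolding ga_def gb_def by (intro smooth_on_mult smooth_on_induced_metric smooth_on_const sm_b S f)+
  define V where "V = (S \<inter> ga -` {0<..}) \<inter> (S \<inter> gb -` {0<..})"
  define e where "e = (\<lambda>i::2. if i = 1 then (\<lambda>u. (ga u powr (-1/2)) *\<^sub>R a) else (\<lambda>u. (gb u powr (-1/2)) *\<^sub>R b u))"
  show thesis
  proof
    show V: "open V"
      unfolding V_def using sm
      by (intro open_Int continuous_open_preimage smooth_on_imp_continuous_on S) auto
    have pos: "x * sgn x > 0" if "x \<noteq> 0" for x :: real
      using that by (simp flip: abs_sgn)
    show "u0 \<in> V"
      using u0 pos[OF a] pos[OF b0] by (simp add: V_def ga_def gb_def mult.commute)
    show VS: "V \<subseteq> S"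
      by (auto simp: V_def)
    have Vpos: "ga u > 0" "gb u > 0" if "u \<in> V" for u
      using that by (auto simp: V_def)
    have smV: "smooth_on ga V" "smooth_on gb V" "smooth_on b V"
      using sm sm_b smooth_on_subset VS by blast+
    have norm: "\<bar>x powr (-1/2) * (x powr (-1/2) * y)\<bar> = 1" if "x > 0" "x = sgn z * y" for x y z :: real
    proof -
      have "x powr (-1/2) * x powr (-1/2) = inverse x"
        using that(1) by (simp only: powr_add[symmetric]) (simp add: powr_minus)
      then have "x powr (-1/2) * (x powr (-1/2) * y) = inverse x * y"
        by (simp only: mult.assoc[symmetric])
      moreover have "\<bar>y\<bar> = x"
        using that by (cases "z > 0"; cases "z = 0") auto
      ultimately show ?thesis
        using that(1) by (simp only: abs_mult) simp
    qed
    show "orthonormal_frame f V e"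
      unfolding orthonormal_frame_def
    proof (intro conjI allI ballI)
      show "smooth_on (e i) V" for i
        unfolding e_def using Vpos
        by (auto intro!: smooth_on_scaleR smooth_on_powr smV V)
      fix u i j assume u: "u \<in> V"
      then have uS: "u \<in> S" using VS by blast
      note bl = bilinear_lmul[OF B[OF uS]] bilinear_rmul[OF B[OF uS]]
      have 11: "\<bar>?g u (e 1 u) (e 1 u)\<bar> = 1"
        using norm[OF Vpos(1)[OF u], of "?g u0 a a" "?g u a a"] by (simp add: e_def bl ga_def)
      have 22: "\<bar>?g u (e 2 u) (e 2 u)\<bar> = 1"
        using norm[OF Vpos(2)[OF u], of "?g u0 (b u0) (b u0)" "?g u (b u) (b u)"] by (simp add: e_def bl gb_def)
      have 12: "?g u (e 1 u) (e 2 u) = 0" "?g u (e 2 u) (e 1 u) = 0"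
        using ab[OF uS] by (simp_all add: e_def bl induced_metric_commute[of f u "b u" a])
      show "if i = j then \<bar>?g u (e i u) (e j u)\<bar> = 1 else ?g u (e i u) (e j u) = 0"
        using exhaust_2[of i] exhaust_2[of j] 11 22 12 by auto
    qed
  qed
qed

lemma tension_eq_trace:
  assumes "smooth_on f S" "open S" "u \<in> S" "\<And>i. smooth_on (e i) S"
  shows "tension f e u = induced_metric f u (e 1 u) (e 1 u) *\<^sub>R covariant_hessian f f u (e 1 u) (e 1 u)
    + induced_metric f u (e 2 u) (e 2 u) *\<^sub>R covariant_hessian f f u (e 2 u) (e 2 u)"
  unfolding tension_def push_def pullback_conn_def sum_2
  by (simp add: covariant_hessian_along_fields[OF assms(1-3) assms(4)])

lemma mean_curvature_eq_tension: "mean_curvature f e u = (1/2) *\<^sub>R tension f e u"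
  by (simp add: mean_curvature_def tension_def second_fundamental_form_def)

lemma ambient_curvature_zero: "ambient_curvature p a b c = 0"
proof -
  have "ambient_conn (\<lambda>_. a) (\<lambda>_. c) = (\<lambda>_. 0)" for a c
    by (simp add: ambient_conn_def fun_eq_iff)
  then show ?thesis
    by (simp add: ambient_curvature_def ambient_conn_def)
qed

lemma bitension_eq_trace:
  assumes "smooth_on (tension f e) S" "open S" "u \<in> S" "\<And>i. smooth_on (e i) S"
  shows "bitension f e u = induced_metric f u (e 1 u) (e 1 u) *\<^sub>R covariant_hessian f (tension f e) u (e 1 u) (e 1 u)
    + induced_metric f u (e 2 u) (e 2 u) *\<^sub>R covariant_hessian f (tension f e) u (e 2 u) (e 2 u)"
proof -
  have "pullback_conn X s = (\<lambda>u. differential s u (X u))" for X s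
    by (simp add: fun_eq_iff pullback_conn_def)
  then show ?thesis
    unfolding bitension_def ambient_curvature_zero sum_2
    by (simp add: covariant_hessian_along_fields[OF assms(1-3) assms(4)])
qed

text \<open>The adapted frame. The field \<open>X1\<close> with \<open>df X1 = J H\<close> has coefficients \<open>P\<close> in the orthonormal frame which are written without the
connection, since the Levi-Civita term is orthogonal to normal vectors; this makes \<open>X1\<close> visibly smooth. Then
\<open>X2\<close> is the complementary null field, and traces over the orthonormal frame become values at \<open>(X1, X2)\<close>. The
structure equations make the covariant derivative of \<open>X2\<close> along \<open>X1\<close> vanish, so the bitension field reduces to an iterated derivative.\<close>

lemma mean_null_frame_exists:
  assumes S: "open S" and f: "smooth_on f S"
    and inj: "\<And>u. u \<in> S \<Longrightarrow> inj (differential f u)"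
    and nd: "\<And>u. u \<in> S \<Longrightarrow> nondegenerate f u"
    and lagrangian: "\<And>u. u \<in> S \<Longrightarrow> J ` tangent_space f u = normal_space f u"
    and mean: "\<And>V e u. open V \<Longrightarrow> V \<subseteq> S \<Longrightarrow> orthonormal_frame f V e \<Longrightarrow> u \<in> V \<Longrightarrow> lightlike (mean_curvature f e u)"
    and bitens: "\<And>V e u. open V \<Longrightarrow> V \<subseteq> S \<Longrightarrow> orthonormal_frame f V e \<Longrightarrow> u \<in> V \<Longrightarrow> lightlike (bitension f e u)"
    and u0: "u0 \<in> S"
  obtains V X1 X2 where "u0 \<in> V" "V \<subseteq> S" "mean_null_frame f V X1 X2"
    "\<And>u. u \<in> V \<Longrightarrow> lightlike (along X1 (along X2 (along X1 f)) u)"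
proof -
  obtain V e where V: "open V" "u0 \<in> V" "V \<subseteq> S" and e: "orthonormal_frame f V e"
    using orthonormal_frame_exists[OF f S u0 nd[OF u0]] by blast
  have fV: "smooth_on f V"
    using smooth_on_subset[OF f V(3)] .
  have sm_e: "smooth_on (e i) V" for i
    using e by (simp add: orthonormal_frame_def)
  define \<epsilon> where "\<epsilon> = (\<lambda>i u. induced_metric f u (e i u) (e i u))"
  have eps: "\<bar>\<epsilon> i u\<bar> = 1" if "u \<in> V" for i u
    using e that by (force simp: orthonormal_frame_def \<epsilon>_def)
  have orth: "induced_metric f u (e 1 u) (e 2 u) = 0" if "u \<in> V" for u
    using e that by (force simp: orthonormal_frame_def)
  have eps_metric: "induced_metric f u (e i u) (e i u) = \<epsilon> i u" for i u
    by (simp add: \<epsilon>_def)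
  note B = bilinear_induced_metric[OF fV V(1)]
  have square: "induced_metric f u (a *\<^sub>R e 1 u + b *\<^sub>R e 2 u) (a *\<^sub>R e 1 u + b *\<^sub>R e 2 u)
      = \<epsilon> 1 u * (a * a) + \<epsilon> 2 u * (b * b)" if u: "u \<in> V" for u a b
    using orth[OF u] induced_metric_commute[of f u "e 2 u" "e 1 u"]
    by (simp add: bilinear_ladd[OF B[OF u]] bilinear_radd[OF B[OF u]] bilinear_lmul[OF B[OF u]] bilinear_rmul[OF B[OF u]]
        algebra_simps eps_metric)
  have isotropic: "lorentz (differential f u v) (J (differential f u w)) = 0" if "u \<in> V" for u v w
  proof -
    have "J (differential f u w) \<in> normal_space f u"
      using lagrangian[of u] that V(3) by (auto simp: tangent_space_def)
    then show ?thesis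
      by (simp add: normal_space_def tangent_space_def)
  qed
  have ndV: "nondegenerate f u" if "u \<in> V" for u
    using nd that V(3) by blast
  define P where "P = (\<lambda>k u. - (1/2) * (\<epsilon> k u *
    (\<epsilon> 1 u * lorentz (along (e 1) (along (e 1) f) u) (J (along (e k) f u))
    + \<epsilon> 2 u * lorentz (along (e 2) (along (e 2) f) u) (J (along (e k) f u)))))"
  define X1 where "X1 = (\<lambda>u. P 1 u *\<^sub>R e 1 u + P 2 u *\<^sub>R e 2 u)"
  define X2 where "X2 = (\<lambda>u. (- \<epsilon> 1 u / (2 * P 1 u)) *\<^sub>R e 1 u + (- \<epsilon> 2 u / (2 * P 2 u)) *\<^sub>R e 2 u)"
  have sm_eps: "smooth_on (\<epsilon> i) V" for i
    unfolding \<epsilon>_def by (intro smooth_on_induced_metric fV sm_e V(1))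
  have sm_P: "smooth_on (P k) V" for k
    unfolding P_def
    by (intro smooth_on_mult smooth_on_add smooth_on_const sm_eps smooth_on_lorentz smooth_on_J smooth_on_along V(1) fV sm_e)
  \<comment> \<open>\<open>H\<close> is normal, hence \<open>J\<close> of some tangent vector; that vector and \<open>- X1\<close> have the same
    products with the orthonormal frame.\<close>
  have H: "mean_curvature f e u = - J (along X1 f u)" if u: "u \<in> V" for u
  proof -
    have "mean_curvature f e u \<in> normal_space f u"
    proof -
      have "lorentz (pullback_conn (e i) (push f (e i)) u - push f (levi_civita f (e i) (e i)) u) (differential f u c) = 0" for i c
        using levi_civita_is_projection[OF fV V(1) u ndV[OF u] sm_e[of i], of "e i" c]
        by (simp add: pullback_conn_def push_def[abs_def])
      then have "lorentz (mean_curvature f e u) (differential f u c) = 0" for c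
        by (simp add: mean_curvature_def second_fundamental_form_def sum_2)
      then show ?thesis
        by (auto simp: normal_space_def tangent_space_def lorentz_commute)
    qed
    then obtain t where t: "mean_curvature f e u = J (differential f u t)"
      using lagrangian[of u] u V(3) by (auto simp: tangent_space_def)
    have gt: "induced_metric f u t (e k u) = - \<epsilon> k u * P k u" for k
    proof -
      have "induced_metric f u t (e k u) = lorentz (mean_curvature f e u) (J (differential f u (e k u)))"
        unfolding t by (simp add: induced_metric_def)
      also have "\<dots> = (1/2) * (\<epsilon> 1 u * lorentz (along (e 1) (along (e 1) f) u) (J (along (e k) f u))
        + \<epsilon> 2 u * lorentz (along (e 2) (along (e 2) f) u) (J (along (e k) f u)))"
        using isotropic[OF u]
        by (simp add: mean_curvature_def second_fundamental_form_def sum_2 pullback_conn_def push_def[abs_def]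
            along_def[abs_def] \<epsilon>_def)
      also have "\<dots> = - \<epsilon> k u * P k u"
      proof -
        define K where "K = \<epsilon> 1 u * lorentz (along (e 1) (along (e 1) f) u) (J (along (e k) f u))
          + \<epsilon> 2 u * lorentz (along (e 2) (along (e 2) f) u) (J (along (e k) f u))"
        have "\<epsilon> k u * \<epsilon> k u = 1"
          using eps[OF u, of k] by (auto simp: abs_if split: if_splits)
        moreover have "- \<epsilon> k u * P k u = (\<epsilon> k u * \<epsilon> k u) * ((1/2) * K)"
          unfolding P_def K_def[symmetric] by simp
        ultimately show ?thesis
          unfolding K_def by simp
      qed
      finally show ?thesis .
    qed
    have "induced_metric f u (t + X1 u) w = 0" for w
    proof (rule orthogonal_to_orthonormal_pair_imp_zero[OF B[OF u] induced_metric_commute])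
      show "\<bar>induced_metric f u (e 1 u) (e 1 u)\<bar> = 1" "\<bar>induced_metric f u (e 2 u) (e 2 u)\<bar> = 1"
        using eps[OF u] by (simp_all add: \<epsilon>_def)
      show "induced_metric f u (e 1 u) (e 2 u) = 0"
        by (rule orth[OF u])
      show "induced_metric f u (t + X1 u) (e 1 u) = 0" "induced_metric f u (t + X1 u) (e 2 u) = 0"
        using orth[OF u] induced_metric_commute[of f u "e 2 u" "e 1 u"]
        by (simp_all add: bilinear_ladd[OF B[OF u]] bilinear_lmul[OF B[OF u]] gt X1_def eps_metric)
    qed
    then have "t + X1 u = 0"
      using ndV[OF u] unfolding nondegenerate_def by blast
    then have "t = - X1 u"
      by (simp add: eq_neg_iff_add_eq_0)
    then show ?thesis
      unfolding t along_def by (simp add: linear_neg[OF linear_differential[OF fV V(1) u]])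
  qed
  \<comment> \<open>A nonzero null vector has two nonzero coefficients in an orthonormal frame, so \<open>X2\<close> is well defined.\<close>
  have null_P: "\<epsilon> 1 u * (P 1 u * P 1 u) + \<epsilon> 2 u * (P 2 u * P 2 u) = 0" "P 1 u \<noteq> 0" "P 2 u \<noteq> 0" if u: "u \<in> V" for u
  proof -
    have l: "along X1 f u \<noteq> 0" "lorentz (along X1 f u) (along X1 f u) = 0"
      using mean[OF V(1,3) e u] unfolding H[OF u] lightlike_def by auto
    have "lorentz (along X1 f u) (along X1 f u) = induced_metric f u (X1 u) (X1 u)"
      by (simp add: along_def induced_metric_def)
    also have "\<dots> = \<epsilon> 1 u * (P 1 u * P 1 u) + \<epsilon> 2 u * (P 2 u * P 2 u)"
      unfolding X1_def by (rule square[OF u])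
    finally show P: "\<epsilon> 1 u * (P 1 u * P 1 u) + \<epsilon> 2 u * (P 2 u * P 2 u) = 0"
      using l(2) by simp
    have "P 1 u \<noteq> 0 \<or> P 2 u \<noteq> 0"
      using l(1) linear_0[OF linear_differential[OF fV V(1) u]] by (auto simp: along_def X1_def)
    moreover have "\<epsilon> 1 u \<noteq> 0" "\<epsilon> 2 u \<noteq> 0"
      using eps[OF u, of 1] eps[OF u, of 2] by auto
    ultimately show "P 1 u \<noteq> 0" "P 2 u \<noteq> 0"
      using P by auto
  qed
  have sm_X1: "smooth_on X1 V"
    unfolding X1_def by (intro smooth_on_add smooth_on_scaleR sm_P sm_e V(1))
  have sm_X2: "smooth_on X2 V"
    unfolding X2_def divide_inverse
    by (intro smooth_on_add smooth_on_scaleR smooth_on_mult smooth_on_minus smooth_on_inverse smooth_on_const sm_P sm_eps sm_e V(1))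
      (use null_P in auto)
  have trace: "C (X1 u) (X2 u) = - (1/2) *\<^sub>R (\<epsilon> 1 u *\<^sub>R C (e 1 u) (e 1 u) + \<epsilon> 2 u *\<^sub>R C (e 2 u) (e 2 u))"
    if u: "u \<in> V" and C: "bilinear C" "\<And>a b. C a b = C b a" for u and C :: "real^2 \<Rightarrow> real^2 \<Rightarrow> 'z::real_vector"
    unfolding X1_def X2_def by (rule trace_null_pair[OF C eps[OF u] eps[OF u] null_P[OF u]])
  have metric12: "induced_metric f u (X1 u) (X2 u) = - 1" if u: "u \<in> V" for u
  proof -
    have "\<epsilon> i u * \<epsilon> i u = 1" for i
      using eps[OF u, of i] by (auto simp: abs_if split: if_splits)
    then show ?thesis
      using trace[OF u B[OF u] induced_metric_commute] by (simp add: eps_metric)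
  qed
  have metric22: "induced_metric f u (X2 u) (X2 u) = 0" if u: "u \<in> V" for u
  proof -
    have s: "\<epsilon> i u * \<epsilon> i u = 1" for i
      using eps[OF u, of i] by (auto simp: abs_if split: if_splits)
    have "induced_metric f u (X2 u) (X2 u) = \<epsilon> 1 u * \<epsilon> 1 u * \<epsilon> 1 u / (4 * (P 1 u * P 1 u)) + \<epsilon> 2 u * \<epsilon> 2 u * \<epsilon> 2 u / (4 * (P 2 u * P 2 u))"
      unfolding X2_def square[OF u] by simp
    also have "\<dots> = (\<epsilon> 1 u * (P 2 u * P 2 u) + \<epsilon> 2 u * (P 1 u * P 1 u)) / (4 * (P 1 u * P 1 u) * (P 2 u * P 2 u))"
      unfolding s using null_P[OF u] by (simp add: field_simps)
    also have "\<epsilon> 1 u * (P 2 u * P 2 u) + \<epsilon> 2 u * (P 1 u * P 1 u)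
      = \<epsilon> 1 u * \<epsilon> 2 u * (\<epsilon> 2 u * (P 2 u * P 2 u) + \<epsilon> 1 u * (P 1 u * P 1 u))"
      using s[of 1] s[of 2] by (simp add: algebra_simps)
    finally show ?thesis
      using null_P(1)[OF u] by (simp add: add.commute)
  qed
  have tension: "tension f e u = - 2 *\<^sub>R J (along X1 f u)" if u: "u \<in> V" for u
  proof -
    have "tension f e u = 2 *\<^sub>R mean_curvature f e u"
      by (simp add: mean_curvature_eq_tension)
    then show ?thesis
      unfolding H[OF u] by simp
  qed
  have along12: "along X1 (along X2 f) u = J (along X1 f u) + differential f u (levi_civita f X1 X2 u)" if u: "u \<in> V" for u
  proof -
    have "covariant_hessian f f u (X1 u) (X2 u) = - (1/2) *\<^sub>R tension f e u"
      unfolding tension_eq_trace[OF fV V(1) u sm_e]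
      using trace[OF u bilinear_covariant_hessian[OF fV V(1) u] covariant_hessian_commute[OF fV fV V(1) u]] by (simp add: \<epsilon>_def)
    also have "\<dots> = J (along X1 f u)"
      unfolding tension[OF u] by simp
    finally show ?thesis
      using covariant_hessian_along_fields[OF fV V(1) u sm_X2, of X1 f] by (simp add: along_def[abs_def] algebra_simps)
  qed
  interpret mean_null_frame f V X1 X2
  proof
    fix u assume u: "u \<in> V"
    show "inj (differential f u)"
      using inj u V(3) by blast
    show "lorentz (differential f u v) (J (differential f u w)) = 0" for v w
      by (rule isotropic[OF u])
    show "lorentz (along X1 f u) (along X1 f u) = 0"
      using mean[OF V(1,3) e u] unfolding H[OF u] lightlike_def by auto
    show "lorentz (along X2 f u) (along X2 f u) = 0" "lorentz (along X1 f u) (along X2 f u) = - 1"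
      using metric22[OF u] metric12[OF u] by (simp_all add: along_def induced_metric_def)
    then show "lorentz (along X1 (along X2 f) u) (J (along X1 f u)) = 0"
      "lorentz (along X1 (along X2 f) u) (J (along X2 f u)) = - 1"
      unfolding along12[OF u] using mean[OF V(1,3) e u] isotropic[OF u]
      by (auto simp: H[OF u] lightlike_def along_def)
  qed (use V(1) fV sm_X1 sm_X2 in auto)
  \<comment> \<open>The structure equations identify the tangential part of the derivative of \<open>e2\<close> along \<open>e1\<close> as \<open>- w1 e2\<close>, and \<open>w1 = 0\<close>.\<close>
  have levi: "levi_civita f X1 X2 u = 0" if u: "u \<in> V" for u
  proof -
    have "differential f u (levi_civita f X1 X2 u) = differential f u 0"
      using along12[OF u] structure_equations(2)[OF u] w1_zero[OF u] linear_0[OF linear_differential[OF fV V(1) u]] by simp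
    then show ?thesis
      using inj[of u] u V(3) by (auto simp: inj_eq)
  qed
  \<comment> \<open>Smoothness of the tension field is read off from its expression in the null frame, which bypasses the
    Christoffel symbols.\<close>
  have sm_tension: "smooth_on (tension f e) V"
    by (rule smooth_on_cong[OF V(1) tension[symmetric]
          smooth_on_scaleR[OF V(1) smooth_on_const smooth_J_frame(1)]])
  have bitension: "bitension f e u = 4 *\<^sub>R J (along X1 (along X2 (along X1 f)) u)" if u: "u \<in> V" for u
  proof -
    have sm: "smooth_on (along X1 f) V" "smooth_on (along X2 (along X1 f)) V"
      by (intro smooth_on_along V(1) fV sm_X1 sm_X2)+
    have scaled: "along Y (\<lambda>x. - 2 *\<^sub>R J (g x)) x = - 2 *\<^sub>R J (along Y g x)" if "smooth_on g V" "x \<in> V" for g :: "real^2 \<Rightarrow> complex^2" and Y x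
      using along_scaleR[OF smooth_on_const smooth_on_J[OF V(1) that(1)] that(2), of Y "- 2"] along_J[OF that, of Y]
      by (simp add: along_def)
    have "along X2 (tension f e) x = - 2 *\<^sub>R J (along X2 (along X1 f) x)" if x: "x \<in> V" for x
      using along_cong_open[OF V(1) x, of "tension f e" "\<lambda>x. - 2 *\<^sub>R J (along X1 f x)" X2] tension
        scaled[OF sm(1) x] by simp
    then have "along X1 (along X2 (tension f e)) u = - 2 *\<^sub>R J (along X1 (along X2 (along X1 f)) u)"
      using along_cong_open[OF V(1) u, of "along X2 (tension f e)" "\<lambda>x. - 2 *\<^sub>R J (along X2 (along X1 f) x)" X1] scaled[OF sm(2) u] by simp
    moreover have "covariant_hessian f (tension f e) u (X1 u) (X2 u) = along X1 (along X2 (tension f e)) u"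
      using covariant_hessian_along_fields[OF sm_tension V(1) u sm_X2, of X1 f] levi[OF u]
        linear_0[OF linear_differential[OF sm_tension V(1) u]] by (simp add: along_def[abs_def])
    moreover have "covariant_hessian f (tension f e) u (X1 u) (X2 u) = - (1/2) *\<^sub>R bitension f e u"
      unfolding bitension_eq_trace[OF sm_tension V(1) u sm_e]
      using trace[OF u bilinear_covariant_hessian[OF sm_tension V(1) u] covariant_hessian_commute[OF fV sm_tension V(1) u]]
      by (simp add: \<epsilon>_def)
    ultimately have "- (1/2) *\<^sub>R bitension f e u = - 2 *\<^sub>R J (along X1 (along X2 (along X1 f)) u)"
      by simp
    then have "- 2 *\<^sub>R (- (1/2) *\<^sub>R bitension f e u) = - 2 *\<^sub>R (- 2 *\<^sub>R J (along X1 (along X2 (along X1 f)) u))"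
      by (rule arg_cong)
    then show ?thesis
      by simp
  qed
  have "lightlike (along X1 (along X2 (along X1 f)) u)" if u: "u \<in> V" for u
    using bitens[OF V(1,3) e u] unfolding bitension[OF u] by (auto simp: lightlike_def)
  then show thesis
    using that[OF V(2,3)] mean_null_frame_axioms by blast
qed

section \<open>Integrating the flat structure equations\<close>

lemma bounded_bilinear_complex_scale: "bounded_bilinear ((*s) :: complex \<Rightarrow> complex^2 \<Rightarrow> complex^2)"
  unfolding bilinear_conv_bounded_bilinear[symmetric] bilinear_def
  by (auto intro!: linearI simp: vec_eq_iff algebra_simps)

lemma lorentz_unitary_scale:
  assumes "norm c = 1"
  shows "lorentz (c *s v) (c *s w) = lorentz v w"
proof -
  have cc: "c * cnj c = 1"
    using assms by (simp add: complex_norm_square[symmetric])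
  have "(c * a) * cnj (c * b) = a * cnj b" for a b
  proof -
    have "(c * a) * cnj (c * b) = (c * cnj c) * (a * cnj b)"
      by (simp add: algebra_simps)
    then show ?thesis by (simp add: cc)
  qed
  then show ?thesis
    unfolding lorentz_def vector_smult_component by (metis mult_minus_left)
qed

lemma J_complex_scale: "J (c *s v) = c *s J v"
  by (simp add: vec_eq_iff)

context mean_null_frame
begin

text \<open>The coframe dual to \<open>X1, X2\<close>; for a null pair with product \<open>- 1\<close> the dual of one vector is minus the product with
the other.\<close>

definition "coframe1 u v = - lorentz (differential f u v) (e2 u)"
definition "coframe2 u v = - lorentz (differential f u v) (e1 u)"

lemma coframe_expansion:
  assumes u: "u \<in> S"
  shows "v = coframe1 u v *\<^sub>R X1 u + coframe2 u v *\<^sub>R X2 u"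
proof -
  have lin: "linear (differential f u)"
    by (rule linear_differential[OF smooth_f open_S u])
  have "differential f u v = coframe1 u v *\<^sub>R e1 u + coframe2 u v *\<^sub>R e2 u"
    using frame_expansion[OF u, of "differential f u v"] isotropic[OF u]
    by (simp add: coframe1_def coframe2_def along_def)
  also have "\<dots> = differential f u (coframe1 u v *\<^sub>R X1 u + coframe2 u v *\<^sub>R X2 u)"
    by (simp add: along_def linear_add[OF lin] linear_cmul[OF lin])
  finally show ?thesis
    using inj[OF u] by (simp add: inj_eq)
qed

lemma linear_coframe:
  assumes "u \<in> S"
  shows "linear (coframe1 u)" "linear (coframe2 u)"
  unfolding coframe1_def coframe2_def using linear_differential[OF smooth_f open_S assms]
  by (auto intro!: linearI simp: linear_add linear_cmul)

lemma coframe_dual: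
  assumes "u \<in> S"
  shows "coframe1 u (X1 u) = 1" "coframe1 u (X2 u) = 0" "coframe2 u (X1 u) = 0" "coframe2 u (X2 u) = 1"
  using null1[OF assms] null2[OF assms] pairing[OF assms]
  by (simp_all add: coframe1_def coframe2_def along_def lorentz_commute)

lemma derivative_in_frame:
  assumes u: "u \<in> S" and s: "s differentiable (at u)"
  shows "frechet_derivative s (at u) v = coframe1 u v *\<^sub>R D1 s u + coframe2 u v *\<^sub>R D2 s u"
proof -
  have lin: "linear (frechet_derivative s (at u))"
    using s by (rule linear_frechet_derivative)
  show ?thesis
    by (subst coframe_expansion[OF u, of v]) (simp add: along_def linear_add[OF lin] linear_cmul[OF lin])
qed

end

lemma one_form_has_potential:
  fixes \<theta> :: "'a::euclidean_space \<Rightarrow> 'a \<Rightarrow> real"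
  assumes lin: "\<And>u. u \<in> ball c r \<Longrightarrow> linear (\<theta> u)" and sm: "\<And>v. smooth_on (\<lambda>u. \<theta> u v) (ball c r)" and r: "r > 0"
    and closed: "\<And>u a b. u \<in> ball c r \<Longrightarrow>
      frechet_derivative (\<lambda>x. \<theta> x b) (at u) a = frechet_derivative (\<lambda>x. \<theta> x a) (at u) b"
  obtains h where "\<And>u. u \<in> ball c r \<Longrightarrow> (h has_derivative \<theta> u) (at u)"
proof -
  define w where "w = (\<lambda>u. \<Sum>b\<in>Basis. \<theta> u b *\<^sub>R b)"
  have w: "w u \<bullet> v = \<theta> u v" if "u \<in> ball c r" for u v
    using linear_basis_expansion[OF lin[OF that], of v]
    by (simp add: w_def inner_sum_right inner_commute[of _ v] mult.commute)
  have sm_w: "smooth_on w (ball c r)"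
    unfolding w_def by (intro smooth_on_sum smooth_on_scaleR smooth_on_const sm) auto
  have "frechet_derivative w (at u) a \<bullet> v = frechet_derivative (\<lambda>x. \<theta> x v) (at u) a" if u: "u \<in> ball c r" for u a v
  proof -
    have "frechet_derivative (\<lambda>x. \<theta> x v) (at u) = frechet_derivative (\<lambda>x. w x \<bullet> v) (at u)"
      by (rule frechet_derivative_cong_open[OF open_ball u]) (simp add: w)
    then show ?thesis
      using frechet_derivative_bounded_linear[OF bounded_linear_inner_left smooth_on_imp_differentiable[OF sm_w u]]
      by simp
  qed
  then obtain h where h: "\<And>u. u \<in> ball c r \<Longrightarrow> (h has_derivative (\<lambda>v. w u \<bullet> v)) (at u)"
    using closed_form_has_potential[OF sm_w r] closed by metis
  show thesis
  proof (rule that)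
    show "(h has_derivative \<theta> u) (at u)" if u: "u \<in> ball c r" for u
      using h[OF u] by (simp only: w[OF u])
  qed
qed

text \<open>Bootstrapping: the derivative of \<open>g\<close> is expressed through \<open>g\<close> and smooth fields, so each derivative of \<open>g\<close> gives
one more.\<close>

lemma smooth_inverse_of_frame_coordinates:
  fixes X1 X2 :: "real^2 \<Rightarrow> real^2"
  assumes R: "open R" and g: "\<And>w. w \<in> R \<Longrightarrow> (g has_derivative (\<lambda>v. v$1 *\<^sub>R X1 (g w) + v$2 *\<^sub>R X2 (g w))) (at w)"
    and gR: "g ` R \<subseteq> S" and X: "smooth_on X1 S" "smooth_on X2 S"
  shows "smooth_on g R"
  unfolding smooth_on_def
proof
  fix k
  show "Ck_on k g R"
  proof (induction k)
    case 0
    show ?case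
      using g by (auto intro!: continuous_at_imp_continuous_on has_derivative_continuous)
  next
    case (Suc k)
    show ?case
    proof (rule Ck_on_SucI[OF R g])
      have "Ck_on k (\<lambda>w. X1 (g w)) R" "Ck_on k (\<lambda>w. X2 (g w)) R"
        using Ck_on_compose[OF R Suc.IH _ gR] X by (auto simp: smooth_on_def)
      then show "Ck_on k (\<lambda>w. v$1 *\<^sub>R X1 (g w) + v$2 *\<^sub>R X2 (g w)) R" for v
        by (intro Ck_on_add[OF R] Ck_on_bounded_linear[OF bounded_linear_scaleR_right R])
    qed
  qed
qed

context mean_null_frame
begin

text \<open>If the frame vectors have purely normal derivatives, that is, if the frame is parallel, then the dual coframe is closed: the
derivative of \<open>\<langle>df b, e2\<rangle>\<close> in the direction \<open>a\<close> is \<open>\<langle>D\<^sup>2 f (a, b), e2\<rangle>\<close>, which is symmetric. Its potentials are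
coordinates for which \<open>X1\<close> and \<open>X2\<close> are the coordinate fields.\<close>

lemma frame_coordinates:
  assumes r: "r > 0" and sub: "ball u0 r \<subseteq> S"
    and normal: "\<And>u v. u \<in> ball u0 r \<Longrightarrow> \<exists>t. differential e1 u v = J (differential f u t)"
      "\<And>u v. u \<in> ball u0 r \<Longrightarrow> \<exists>t. differential e2 u v = J (differential f u t)"
  obtains \<psi> g :: "real^2 \<Rightarrow> real^2" and U V where "open U" "u0 \<in> U" "U \<subseteq> ball u0 r" "open V" "homeomorphism U V \<psi> g"
    "smooth_on \<psi> U" "smooth_on g V"
    "\<And>w. w \<in> V \<Longrightarrow> (g has_derivative (\<lambda>v. v$1 *\<^sub>R X1 (g w) + v$2 *\<^sub>R X2 (g w))) (at w)"
proof -
  let ?B = "ball u0 r"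
  have smB: "smooth_on f ?B" "smooth_on e1 ?B" "smooth_on e2 ?B"
    using smooth_f smooth_frame sub smooth_on_subset by blast+
  have sm: "smooth_on (\<lambda>u. coframe1 u v) ?B" "smooth_on (\<lambda>u. coframe2 u v) ?B" for v
    unfolding coframe1_def coframe2_def
    by (intro smooth_on_minus smooth_on_lorentz smooth_on_frechet_derivative smooth_on_const open_ball smB)+
  have D: "frechet_derivative (\<lambda>x. - lorentz (differential f x b) (e x)) (at u) a = - lorentz (hessian f u a b) (e u)"
    if u: "u \<in> ?B" and e: "smooth_on e ?B" "\<exists>t. differential e u a = J (differential f u t)" for u a b e
  proof -
    have "smooth_on (\<lambda>x. differential f x b) ?B"
      by (intro smooth_on_frechet_derivative smooth_on_const open_ball smB)
    note d = smooth_on_imp_differentiable[OF this u] smooth_on_imp_differentiable[OF e(1) u]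
    have "u \<in> S" using u sub by blast
    have "frechet_derivative (\<lambda>x. lorentz (differential f x b) (e x)) (at u) a = lorentz (hessian f u a b) (e u)"
      using e(2) isotropic[OF \<open>u \<in> S\<close>] unfolding frechet_derivative_bilinear[OF bounded_bilinear_lorentz d]
      by (auto simp: hessian_def)
    moreover have "(\<lambda>x. lorentz (differential f x b) (e x)) differentiable (at u)"
      by (intro smooth_on_imp_differentiable[OF smooth_on_lorentz u] e smooth_on_frechet_derivative smooth_on_const open_ball smB)
    ultimately show ?thesis
      using frechet_derivative_bounded_linear[OF bounded_linear_minus[OF bounded_linear_ident]] by fastforce
  qed
  have lin: "linear (coframe1 u)" "linear (coframe2 u)" if "u \<in> ?B" for u
    using linear_coframe that sub by blast+
  have closed1: "frechet_derivative (\<lambda>x. coframe1 x b) (at u) a = frechet_derivative (\<lambda>x. coframe1 x a) (at u) b"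
    if u: "u \<in> ?B" for u a b
    unfolding coframe1_def D[OF u smB(3) normal(2)[OF u]] hessian_commute[OF smB(1) open_ball u, of a b] ..
  obtain h1 where h1: "\<And>u. u \<in> ?B \<Longrightarrow> (h1 has_derivative coframe1 u) (at u)"
    using one_form_has_potential[OF lin(1) sm(1) r closed1] by blast
  have closed2: "frechet_derivative (\<lambda>x. coframe2 x b) (at u) a = frechet_derivative (\<lambda>x. coframe2 x a) (at u) b"
    if u: "u \<in> ?B" for u a b
    unfolding coframe2_def D[OF u smB(2) normal(1)[OF u]] hessian_commute[OF smB(1) open_ball u, of a b] ..
  obtain h2 where h2: "\<And>u. u \<in> ?B \<Longrightarrow> (h2 has_derivative coframe2 u) (at u)"
    using one_form_has_potential[OF lin(2) sm(2) r closed2] by blast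
  define \<psi> :: "real^2 \<Rightarrow> real^2" where "\<psi> = (\<lambda>u. h1 u *\<^sub>R axis 1 1 + h2 u *\<^sub>R axis 2 1)"
  define \<psi>' :: "real^2 \<Rightarrow> real^2 \<Rightarrow> real^2" where "\<psi>' = (\<lambda>u v. coframe1 u v *\<^sub>R axis 1 1 + coframe2 u v *\<^sub>R axis 2 1)"
  have comp: "\<psi>' u v $ 1 = coframe1 u v" "\<psi>' u v $ 2 = coframe2 u v" for u v
    by (simp_all add: \<psi>'_def axis_def)
  have der: "(\<psi> has_derivative \<psi>' u) (at u)" if "u \<in> ?B" for u
    unfolding \<psi>_def \<psi>'_def using h1[OF that] h2[OF that]
    by (intro has_derivative_add has_derivative_scaleR_left)
  have sm\<psi>': "smooth_on (\<lambda>u. \<psi>' u v) ?B" for v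
    unfolding \<psi>'_def by (intro smooth_on_add smooth_on_scaleR smooth_on_const sm open_ball)
  have sm\<psi>: "smooth_on \<psi> ?B"
    by (rule smooth_onI_derivative[OF open_ball der sm\<psi>'])
  define Y :: "real^2 \<Rightarrow> real^2 \<Rightarrow> real^2" where "Y = (\<lambda>u v. v$1 *\<^sub>R X1 u + v$2 *\<^sub>R X2 u)"
  have Y\<psi>: "Y u (\<psi>' u v) = v" if "u \<in> ?B" for u v
    using coframe_expansion[of u v] that sub unfolding Y_def comp by auto
  have \<psi>Y: "\<psi>' u (Y u v) = v" if "u \<in> ?B" for u v
  proof -
    have "u \<in> S" using that sub by blast
    then show ?thesis
      using coframe_dual[of u] lin[OF that] unfolding vec_eq_iff forall_2 comp Y_def
      by (simp add: linear_add linear_cmul)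
  qed
  have bl: "bounded_linear (\<psi>' u)" if "u \<in> ?B" for u
    using der[OF that] by (rule has_derivative_bounded_linear)
  have blY: "bounded_linear (Y u)" for u
    unfolding Y_def linear_conv_bounded_linear[symmetric] by (auto intro!: linearI simp: algebra_simps)
  define F where "F = (\<lambda>u. Blinfun (\<psi>' u))"
  have F: "blinfun_apply (F u) = \<psi>' u" if "u \<in> ?B" for u
    unfolding F_def using bl[OF that] by (rule bounded_linear_Blinfun_apply)
  have u0: "u0 \<in> ?B" using r by simp
  obtain U V g g' where U: "open U" "U \<subseteq> ?B" "u0 \<in> U" and V: "open V" and hom: "homeomorphism U V \<psi> g"
    and g: "\<And>y. y \<in> V \<Longrightarrow> (g has_derivative (g' y)) (at y)" "\<And>y. y \<in> V \<Longrightarrow> g' y = inv (blinfun_apply (F (g y)))"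
  proof (rule inverse_function_theorem[OF open_ball _ _ u0, of \<psi> F "Blinfun (Y u0)"])
    show "(\<psi> has_derivative blinfun_apply (F x)) (at x)" if "x \<in> ?B" for x
      unfolding F[OF that] by (rule der[OF that])
    show "continuous_on ?B F"
    proof (rule continuous_on_blinfun_componentwise)
      show "continuous_on ?B (\<lambda>x. blinfun_apply (F x) i)" for i
        by (rule continuous_on_eq[OF smooth_on_imp_continuous_on[OF sm\<psi>'[of i]]]) (simp add: F)
    qed
    show "Blinfun (Y u0) o\<^sub>L F u0 = id_blinfun"
      by (rule blinfun_eqI) (simp add: F[OF u0] bounded_linear_Blinfun_apply[OF blY] Y\<psi>[OF u0])
  qed blast
  have gV: "g w \<in> U" if "w \<in> V" for w
    using hom that by (auto simp: homeomorphism_def)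
  have gder: "(g has_derivative (\<lambda>v. v$1 *\<^sub>R X1 (g w) + v$2 *\<^sub>R X2 (g w))) (at w)" if w: "w \<in> V" for w
  proof -
    have gB: "g w \<in> ?B" using gV[OF w] U(2) by blast
    have "inv (\<psi>' (g w)) = Y (g w)"
      by (rule inv_equality) (auto simp: Y\<psi>[OF gB] \<psi>Y[OF gB])
    then show ?thesis
      using g(1)[OF w] unfolding g(2)[OF w] F[OF gB] by (simp add: Y_def)
  qed
  show thesis
  proof (rule that[OF U(1,3,2) V hom])
    show "smooth_on \<psi> U"
      using sm\<psi> U(2) smooth_on_subset by blast
    show "smooth_on g V"
      by (rule smooth_inverse_of_frame_coordinates[OF V gder _ smooth_X1 smooth_X2]) (use gV U(2) sub in auto)
  qed (rule gder)
qed

text \<open>Integration of the flat structure equations in coordinates \<open>x, y\<close> of the frame. The vector \<open>\<zeta> = f - c = - J e2\<close> satisfies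
\<open>\<partial>\<^sub>y \<zeta> = J \<zeta>\<close>, so \<open>e\<^sup>-\<^sup>i\<^sup>y \<zeta>\<close> depends on \<open>x\<close> only and is the curve \<open>z\<close>. Its derivatives
are \<open>e\<^sup>-\<^sup>i\<^sup>y e1\<close> and \<open>e\<^sup>-\<^sup>i\<^sup>y k1 J e2\<close>, and multiplication by \<open>e\<^sup>-\<^sup>i\<^sup>y\<close> is an isometry, so everything claimed about \<open>z\<close> is a
relation between the frame vectors; \<open>z''\<close> is nonzero because \<open>k1\<close> is.\<close>

lemma local_normal_form:
  assumes ll: "\<And>u. u \<in> S \<Longrightarrow> lightlike (D1 (D2 e1) u)" and u0: "u0 \<in> S"
  obtains \<psi> g :: "real^2 \<Rightarrow> real^2" and U R I z c where "open U" "u0 \<in> U" "U \<subseteq> S" "open R" "homeomorphism U R \<psi> g"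
    "smooth_on \<psi> U" "smooth_on g R"
    "open I" "is_interval I" "\<And>u. u \<in> U \<Longrightarrow> \<psi> u $ 1 \<in> I"
    "null_curve z I" "z ` I \<subseteq> light_cone"
    "\<And>x. x \<in> I \<Longrightarrow> lorentz (z x) (J (velocity z x)) = 1"
    "\<And>x. x \<in> I \<Longrightarrow> acceleration z x \<noteq> 0"
    "\<And>u. u \<in> U \<Longrightarrow> f u = exp (\<i> * of_real (\<psi> u $ 2)) *s z (\<psi> u $ 1) + c"
proof -
  have D: "D1 e1 u = k1 u *\<^sub>R J (e2 u)" "D1 e2 u = J (e1 u)" "D2 e1 u = J (e1 u)" "D2 e2 u = J (e2 u)" "k1 u \<noteq> 0"
    if "u \<in> S" for u
    using structure_equations[OF that] w1_zero[OF that] lightlike_imp_flat[OF ll that] by auto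
  have df: "differential f u (a *\<^sub>R X1 u + b *\<^sub>R X2 u) = a *\<^sub>R e1 u + b *\<^sub>R e2 u" if "u \<in> S" for u a b
    using linear_differential[OF smooth_f open_S that] by (simp add: linear_add linear_cmul along_def)
  have de: "differential e1 u v = J (coframe1 u v *\<^sub>R k1 u *\<^sub>R e2 u + coframe2 u v *\<^sub>R e1 u)"
    "differential e2 u v = J (coframe1 u v *\<^sub>R e1 u + coframe2 u v *\<^sub>R e2 u)" if u: "u \<in> S" for u v
    using derivative_in_frame[OF u smooth_on_imp_differentiable[OF smooth_frame(1) u], of v]
      derivative_in_frame[OF u smooth_on_imp_differentiable[OF smooth_frame(2) u], of v] D[OF u] by auto
  obtain r where r: "r > 0" "ball u0 r \<subseteq> S"
    using open_S u0 open_contains_ball by blast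
  have n1: "\<exists>t. differential e1 u v = J (differential f u t)" and n2: "\<exists>t. differential e2 u v = J (differential f u t)"
    if "u \<in> ball u0 r" for u v
  proof -
    have u: "u \<in> S" using that r by blast
    show "\<exists>t. differential e1 u v = J (differential f u t)"
      by (rule exI[of _ "coframe2 u v *\<^sub>R X1 u + (coframe1 u v * k1 u) *\<^sub>R X2 u"])
        (simp add: de(1)[OF u] df[OF u])
    show "\<exists>t. differential e2 u v = J (differential f u t)"
      by (rule exI[of _ "coframe1 u v *\<^sub>R X1 u + coframe2 u v *\<^sub>R X2 u"])
        (simp only: de(2)[OF u] df[OF u])
  qed
  obtain \<psi> g :: "real^2 \<Rightarrow> real^2" and U V where U: "open U" "u0 \<in> U" "U \<subseteq> ball u0 r" and V: "open V" and hom: "homeomorphism U V \<psi> g"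
    and sm: "smooth_on \<psi> U" "smooth_on g V"
    and gder: "\<And>w. w \<in> V \<Longrightarrow> (g has_derivative (\<lambda>v. v$1 *\<^sub>R X1 (g w) + v$2 *\<^sub>R X2 (g w))) (at w)"
    by (rule frame_coordinates[OF r n1 n2]; (assumption | (rule that, assumption+)))
  have gU: "g w \<in> U" and gS: "g w \<in> S" and \<psi>g: "\<psi> (g w) = w" if "w \<in> V" for w
    using hom that U(3) r(2) by (auto simp: homeomorphism_def)
  have "\<exists>c. \<forall>u\<in>ball u0 r. f u + J (e2 u) = c"
  proof (rule has_derivative_zero_constant)
    show "((\<lambda>u. f u + J (e2 u)) has_derivative (\<lambda>v. 0)) (at u within ball u0 r)" if "u \<in> ball u0 r" for u
    proof -
      have u: "u \<in> S" using that r by blast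
      have "((\<lambda>u. f u + J (e2 u)) has_derivative (\<lambda>v. differential f u v + J (differential e2 u v))) (at u)"
        by (intro has_derivative_add bounded_linear.has_derivative[OF bounded_linear_J]
            smooth_on_has_derivative[OF smooth_f u] smooth_on_has_derivative[OF smooth_frame(2) u])
      moreover have "differential f u v + J (differential e2 u v) = 0" for v
        using derivative_in_frame[OF u smooth_on_imp_differentiable[OF smooth_f u], of v] de(2)[OF u, of v] by simp
      ultimately show ?thesis
        by (simp add: has_derivative_at_withinI)
    qed
  qed simp
  then obtain c where c: "\<And>u. u \<in> ball u0 r \<Longrightarrow> f u + J (e2 u) = c"
    by blast
  \<comment> \<open>The coordinate domain is shrunk to a rectangle, so that \<open>y\<close> runs through an interval for every fixed \<open>x\<close>.\<close>
  define w0 where "w0 = \<psi> u0"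
  have w0: "w0 \<in> V" "g w0 = u0"
    using hom U(2) by (auto simp: homeomorphism_def w0_def)
  obtain d where d: "d > 0" "ball w0 d \<subseteq> V"
    using V w0 open_contains_ball by blast
  define I K where "I = {w0 $ 1 - d/2 <..< w0 $ 1 + d/2}" and "K = {w0 $ 2 - d/2 <..< w0 $ 2 + d/2}"
  define R where "R = {w :: real^2. w $ 1 \<in> I \<and> w $ 2 \<in> K}"
  have RV: "R \<subseteq> V"
  proof
    fix w assume "w \<in> R"
    then have "\<bar>w $ 1 - w0 $ 1\<bar> < d/2" "\<bar>w $ 2 - w0 $ 2\<bar> < d/2"
      unfolding R_def I_def K_def mem_Collect_eq greaterThanLessThan_iff abs_less_iff by linarith+
    then have "norm (w - w0) < d"
      using norm_le_l1_cart[of "w - w0"] by (simp add: sum_2)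
    then show "w \<in> V"
      using d(2) by (auto simp: dist_norm norm_minus_commute)
  qed
  have openR: "open R"
  proof -
    have "R = (\<lambda>w. w $ 1) -` I \<inter> (\<lambda>w. w $ 2) -` K"
      by (auto simp: R_def)
    moreover have "open I" "open K" by (auto simp: I_def K_def)
    ultimately show ?thesis
      by (auto intro!: open_Int continuous_open_vimage continuous_intros)
  qed
  define N where "N = {u \<in> U. \<psi> u \<in> R}"
  have openN: "open N"
  proof -
    have "N = U \<inter> \<psi> -` R" by (auto simp: N_def)
    then show ?thesis
      using continuous_open_preimage[OF smooth_on_imp_continuous_on[OF sm(1)] U(1) openR] by simp
  qed
  have homN: "homeomorphism N R \<psi> g"
  proof (rule homeomorphism_of_subsets[OF hom])
    show "N \<subseteq> U" "R \<subseteq> V" using RV by (auto simp: N_def)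
    show "\<psi> ` N = R"
      using RV gU \<psi>g by (force simp: N_def)
  qed
  have w0R: "w0 \<in> R" using d(1) by (simp add: R_def I_def K_def)
  define y0 where "y0 = w0 $ 2"
  define pt where "pt = (\<lambda>x y. x *\<^sub>R axis 1 1 + y *\<^sub>R (axis 2 1 :: real^2))"
  have pt: "pt x y $ 1 = x" "pt x y $ 2 = y" for x y
    by (simp_all add: pt_def axis_def)
  have ptR: "pt x y \<in> R" if "x \<in> I" "y \<in> K" for x y
    using that by (simp add: R_def pt)
  have ptS: "g (pt x y) \<in> S" if "x \<in> I" "y \<in> K" for x y
    using gS ptR[OF that] RV by blast
  have y0: "y0 \<in> K" using d(1) by (simp add: K_def y0_def)
  have dg: "((\<lambda>w. s (g w)) has_derivative (\<lambda>v. v$1 *\<^sub>R D1 s (g w) + v$2 *\<^sub>R D2 s (g w))) (at w)"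
    if w: "w \<in> R" and s: "smooth_on s S" for w and s :: "real^2 \<Rightarrow> complex^2"
  proof -
    have wV: "w \<in> V" using w RV by blast
    have "((\<lambda>w. s (g w)) has_derivative (\<lambda>v. frechet_derivative s (at (g w)) (v$1 *\<^sub>R X1 (g w) + v$2 *\<^sub>R X2 (g w)))) (at w)"
      using gder[OF wV] smooth_on_has_derivative[OF s gS[OF wV]] by (rule has_derivative_compose)
    moreover have "linear (frechet_derivative s (at (g w)))"
      by (intro linear_frechet_derivative smooth_on_imp_differentiable[OF s gS[OF wV]])
    ultimately show ?thesis
      by (simp add: linear_add linear_cmul along_def)
  qed
  have dx: "((\<lambda>x. s (g (pt x y))) has_vector_derivative D1 s (g (pt x y))) (at x)"
    and dy: "((\<lambda>y. s (g (pt x y))) has_vector_derivative D2 s (g (pt x y))) (at y)"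
    if "x \<in> I" "y \<in> K" and s: "smooth_on s S" for x y and s :: "real^2 \<Rightarrow> complex^2"
  proof -
    have "((\<lambda>x. pt x y) has_derivative (\<lambda>h. h *\<^sub>R axis 1 1)) (at x)"
      "((\<lambda>y. pt x y) has_derivative (\<lambda>h. h *\<^sub>R axis 2 1)) (at y)"
      unfolding pt_def by (auto intro!: derivative_eq_intros)
    from this[THEN has_derivative_compose, OF dg[OF ptR[OF that(1,2)] s]]
    show "((\<lambda>x. s (g (pt x y))) has_vector_derivative D1 s (g (pt x y))) (at x)"
      "((\<lambda>y. s (g (pt x y))) has_vector_derivative D2 s (g (pt x y))) (at y)"
      by (simp_all add: has_vector_derivative_def axis_def)
  qed
  define \<zeta> where "\<zeta> = (\<lambda>w. - J (e2 (g w)))"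
  define E where "E = (\<lambda>y::real. exp (- (\<i> * of_real y)))"
  have normE: "norm (E y) = 1" for y
    by (simp add: E_def)
  have E_inverse: "exp (\<i> * of_real y) *s (E y *s v) = v" for y and v :: "complex^2"
    by (simp add: E_def vec_eq_iff exp_minus)
  define z where "z = (\<lambda>x. E y0 *s \<zeta> (pt x y0))"
  have spiral: "E y *s \<zeta> (pt x y) = z x" if x: "x \<in> I" and y: "y \<in> K" for x y
  proof -
    have "\<exists>c. \<forall>y\<in>K. E y *s \<zeta> (pt x y) = c"
    proof (rule has_derivative_zero_constant)
      show "convex K" by (simp add: K_def)
      fix y assume y: "y \<in> K"
      have 1: "((\<lambda>y. \<zeta> (pt x y)) has_vector_derivative - J (J (e2 (g (pt x y))))) (at y)"
        using bounded_linear.has_vector_derivative[OF bounded_linear_minus[OF bounded_linear_J] dy[OF x y smooth_frame(2)]]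
        unfolding \<zeta>_def D(4)[OF ptS[OF x y]] .
      have 2: "(E has_vector_derivative - \<i> * E y) (at y)"
        unfolding E_def by (rule has_vector_derivative_real_field) (auto intro!: derivative_eq_intros)
      have "((\<lambda>y. E y *s \<zeta> (pt x y)) has_vector_derivative
          E y *s (- J (J (e2 (g (pt x y))))) + (- \<i> * E y) *s \<zeta> (pt x y)) (at y)"
        by (rule bounded_bilinear.has_vector_derivative[OF bounded_bilinear_complex_scale 2 1])
      moreover have "E y *s (- J (J (e2 (g (pt x y))))) + (- \<i> * E y) *s \<zeta> (pt x y) = 0"
        by (simp add: \<zeta>_def vec_eq_iff algebra_simps)
      ultimately have "((\<lambda>y. E y *s \<zeta> (pt x y)) has_vector_derivative 0) (at y)"
        by simp
      then show "((\<lambda>y. E y *s \<zeta> (pt x y)) has_derivative (\<lambda>h. 0)) (at y within K)"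
        by (simp add: has_vector_derivative_def has_derivative_at_withinI)
    qed
    then show ?thesis
      unfolding z_def using y y0 by metis
  qed
  have z1: "(z has_vector_derivative E y0 *s e1 (g (pt x y0))) (at x)" if x: "x \<in> I" for x
  proof -
    have "((\<lambda>x. \<zeta> (pt x y0)) has_vector_derivative - J (J (e1 (g (pt x y0))))) (at x)"
      using bounded_linear.has_vector_derivative[OF bounded_linear_minus[OF bounded_linear_J] dx[OF x y0 smooth_frame(2)]]
      unfolding \<zeta>_def D(2)[OF ptS[OF x y0]] .
    from bounded_linear.has_vector_derivative[OF bounded_bilinear.bounded_linear_right[OF bounded_bilinear_complex_scale, of "E y0"] this]
    show ?thesis
      unfolding z_def by simp
  qed
  have vel: "velocity z x = E y0 *s e1 (g (pt x y0))" if "x \<in> I" for x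
    using z1[OF that] by (rule vector_derivative_at)
  have acc: "acceleration z x = E y0 *s (k1 (g (pt x y0)) *\<^sub>R J (e2 (g (pt x y0))))" if x: "x \<in> I" for x
  proof (rule vector_derivative_at)
    have "((\<lambda>x. E y0 *s e1 (g (pt x y0))) has_vector_derivative E y0 *s (k1 (g (pt x y0)) *\<^sub>R J (e2 (g (pt x y0))))) (at x)"
      using bounded_linear.has_vector_derivative[OF bounded_bilinear.bounded_linear_right[OF bounded_bilinear_complex_scale, of "E y0"]
          dx[OF x y0 smooth_frame(1)]]
      unfolding D(1)[OF ptS[OF x y0]] .
    then show "(velocity z has_vector_derivative E y0 *s (k1 (g (pt x y0)) *\<^sub>R J (e2 (g (pt x y0))))) (at x)"
      by (rule has_vector_derivative_transform_within_open[of _ _ _ I]) (use x vel in \<open>auto simp: I_def\<close>)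
  qed
  have frame_ne: "E y *s e1 u \<noteq> 0" "E y *s J (e2 u) \<noteq> 0" if "u \<in> S" for u y
  proof -
    have "lorentz (E y *s e1 u) (E y *s e2 u) = - 1" "lorentz (E y *s J (e2 u)) (E y *s J (e1 u)) = - 1"
      using pairing[OF that] by (simp_all add: lorentz_unitary_scale[OF normE] lorentz_commute)
    then show "E y *s e1 u \<noteq> 0" "E y *s J (e2 u) \<noteq> 0"
      by auto
  qed
  show thesis
  proof (rule that[OF openN _ _ openR homN])
    show "u0 \<in> N" using U(2) w0R by (simp add: N_def w0_def)
    show "N \<subseteq> S" using U(3) r(2) by (auto simp: N_def)
    show "smooth_on \<psi> N" using sm(1) by (rule smooth_on_subset) (auto simp: N_def)
    show "smooth_on g R" using sm(2) RV by (rule smooth_on_subset)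
    show "open I" "is_interval I" by (auto simp: I_def is_interval_oo)
    show "\<psi> u $ 1 \<in> I" if "u \<in> N" for u
      using that by (simp add: N_def R_def)
    show "null_curve z I"
      unfolding null_curve_def
    proof
      have "open I" by (simp add: I_def)
      have pt_sm: "smooth_on (\<lambda>x. pt x y0) I"
        by (rule smooth_onI_derivative[OF \<open>open I\<close>, of _ "\<lambda>_ h. h *\<^sub>R axis 1 1"])
          (auto intro!: derivative_eq_intros simp: pt_def)
      have "smooth_on (\<lambda>w. - J (e2 (g w))) R"
      proof (intro smooth_on_minus smooth_on_J openR)
        show "smooth_on (\<lambda>w. e2 (g w)) R"
          by (rule smooth_on_compose[OF openR smooth_on_subset[OF sm(2) RV] smooth_frame(2)])
            (use gS RV in auto)
      qed
      then have "smooth_on (\<lambda>x. \<zeta> (pt x y0)) I"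
        unfolding \<zeta>_def using smooth_on_compose[OF \<open>open I\<close> pt_sm] ptR y0 by fastforce
      then show "smooth_on z I"
        unfolding z_def
        by (rule smooth_on_bounded_linear[OF bounded_bilinear.bounded_linear_right[OF bounded_bilinear_complex_scale] \<open>open I\<close>])
      show "\<forall>t\<in>I. lightlike (velocity z t)"
        using null1[OF ptS[OF _ y0]] frame_ne(1)[OF ptS[OF _ y0]]
        by (auto simp: vel lightlike_def lorentz_unitary_scale[OF normE])
    qed
    show "z ` I \<subseteq> light_cone"
      using null2[OF ptS[OF _ y0]] by (auto simp: light_cone_def z_def \<zeta>_def lorentz_unitary_scale[OF normE])
    show "lorentz (z x) (J (velocity z x)) = 1" if "x \<in> I" for x
      using pairing[OF ptS[OF that y0]] unfolding vel[OF that]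
      by (simp add: z_def \<zeta>_def J_complex_scale lorentz_unitary_scale[OF normE] lorentz_commute)
    show "acceleration z x \<noteq> 0" if "x \<in> I" for x
    proof -
      have "E y0 *s (k *\<^sub>R v) = k *\<^sub>R (E y0 *s v)" for k v
        by (simp add: vec_eq_iff)
      then show ?thesis
        unfolding acc[OF that] using frame_ne(2)[OF ptS[OF that y0]] D(5)[OF ptS[OF that y0]] by simp
    qed
    show "f u = exp (\<i> * of_real (\<psi> u $ 2)) *s z (\<psi> u $ 1) + c" if u: "u \<in> N" for u
    proof -
      have "g (\<psi> u) = u" "\<psi> u \<in> R" "u \<in> ball u0 r"
        using u homN U(3) by (auto simp: N_def homeomorphism_def)
      moreover have "pt (\<psi> u $ 1) (\<psi> u $ 2) = \<psi> u"
        by (simp add: vec_eq_iff forall_2 pt)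
      ultimately have "exp (\<i> * of_real (\<psi> u $ 2)) *s z (\<psi> u $ 1) = - J (e2 u)"
        using spiral[of "\<psi> u $ 1" "\<psi> u $ 2", symmetric] E_inverse by (simp add: R_def \<zeta>_def)
      then show ?thesis
        using c[OF \<open>u \<in> ball u0 r\<close>] by (simp add: algebra_simps)
    qed
  qed
qed

end

section \<open>Charts\<close>

lemma chart_inj_on: "is_chart X (U, c) \<Longrightarrow> inj_on c U"
  unfolding is_chart_def using homeomorphic_imp_injective_map openin_subset
  by (metis (no_types, lifting) case_prod_conv inf.absorb_iff2 topspace_subtopology)

lemma open_chart_image:
  assumes "is_chart X (U, c)" "openin X W" "W \<subseteq> U"
  shows "open (c ` W)"
proof -
  have "openin X U" "open (c ` U)" and hom: "homeomorphic_map (subtopology X U) (top_of_set (c ` U)) c"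
    using assms(1) by (auto simp: is_chart_def)
  have "openin (subtopology X U) W"
    using assms(2,3) by (metis inf.absorb_iff1 openin_subtopology)
  then have "openin (top_of_set (c ` U)) (c ` W)"
    using homeomorphic_map_openness_eq[OF hom] by blast
  then show ?thesis
    using \<open>open (c ` U)\<close> openin_open_trans by blast
qed

lemma homeomorphism_imp_homeomorphic_map:
  assumes "homeomorphism N R \<psi> g"
  shows "homeomorphic_map (top_of_set N) (top_of_set R) \<psi>"
proof -
  have "homeomorphic_maps (top_of_set N) (top_of_set R) \<psi> g"
    using assms by (auto simp: homeomorphic_maps_def homeomorphism_def)
  then show ?thesis
    using homeomorphic_map_maps by blast
qed

text \<open>Composing a chart with a local diffeomorphism of the plane gives a chart of the maximal atlas: its transition maps to the
charts of the atlas are transition maps of the old chart composed with the diffeomorphism or its inverse.\<close>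

lemma smooth_chart_change_coordinates:
  fixes \<psi> g :: "real^2 \<Rightarrow> real^2"
  assumes surface: "smooth_surface X \<A>" and chart: "(U, c) \<in> \<A>"
    and N: "open N" "N \<subseteq> c ` U" and R: "open R" and hom: "homeomorphism N R \<psi> g"
    and smooth: "smooth_on \<psi> N" "smooth_on g R"
  shows "smooth_chart X \<A> ({q \<in> U. c q \<in> N}, \<psi> \<circ> c)"
proof -
  define W where "W = {q \<in> U. c q \<in> N}"
  have is_chart: "is_chart X \<kappa>" if "\<kappa> \<in> \<A>" for \<kappa>
    using surface that by (auto simp: smooth_surface_def)
  have Uc: "openin X U" and homc: "homeomorphic_map (subtopology X U) (top_of_set (c ` U)) c"
    using is_chart[OF chart] by (auto simp: is_chart_def)
  have inj: "inj_on c U"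
    by (rule chart_inj_on[OF is_chart[OF chart]])
  have UX: "U \<subseteq> topspace X"
    using Uc by (rule openin_subset)
  have cW: "c ` W = N"
    using N(2) by (auto simp: W_def)
  have homg: "g y \<in> N" "\<psi> (g y) = y" if "y \<in> R" for y
    using hom that by (auto simp: homeomorphism_def)
  have homf: "\<psi> x \<in> R" "g (\<psi> x) = x" if "x \<in> N" for x
    using hom that by (auto simp: homeomorphism_def)
  have "\<psi> ` N = R"
    using hom by (simp add: homeomorphism_def)
  then have image: "(\<psi> \<circ> c) ` W = R"
    unfolding image_comp[symmetric] cW .
  have W_open: "openin X W"
  proof -
    have "openin (top_of_set (c ` U)) (c ` W)"
      unfolding cW using N by (metis inf.absorb_iff2 open_subset)
    then have "openin (subtopology X U) W"
      using homeomorphic_map_openness[OF homc, of W] UX by (auto simp: W_def)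
    then show ?thesis
      using openin_trans_full[OF _ Uc] by blast
  qed
  have chartW: "is_chart X (W, \<psi> \<circ> c)"
  proof -
    have "homeomorphic_map (subtopology (subtopology X U) W) (subtopology (top_of_set (c ` U)) N) c"
      by (rule homeomorphic_map_subtopologies[OF homc]) (use UX cW N(2) in \<open>auto simp: W_def\<close>)
    moreover have "U \<inter> W = W" "c ` U \<inter> N = N"
      using N(2) by (auto simp: W_def)
    ultimately have "homeomorphic_map (subtopology X W) (top_of_set N) c"
      by (simp add: subtopology_subtopology)
    then have "homeomorphic_map (subtopology X W) (top_of_set R) (\<psi> \<circ> c)"
      using homeomorphism_imp_homeomorphic_map[OF hom] by (rule homeomorphic_map_compose)
    then show ?thesis
      unfolding is_chart_def case_prod_conv image using W_open R by blast
  qed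
  have inv: "inv_into W (\<psi> \<circ> c) y = inv_into U c (g y)" if "y \<in> R" for y
  proof (rule inv_into_f_eq)
    show "inj_on (\<psi> \<circ> c) W"
      by (rule chart_inj_on[OF chartW])
    have gU: "g y \<in> c ` U"
      using homg[OF that] N(2) by blast
    show "inv_into U c (g y) \<in> W"
      using inv_into_into[OF gU] f_inv_into_f[OF gU] homg[OF that] by (simp add: W_def)
    show "(\<psi> \<circ> c) (inv_into U c (g y)) = y"
      using f_inv_into_f[OF gU] homg[OF that] by simp
  qed
  have "compatible (W, \<psi> \<circ> c) \<kappa>'" if \<kappa>': "\<kappa>' \<in> \<A>" for \<kappa>'
  proof -
    obtain V d where [simp]: "\<kappa>' = (V, d)" by (cases \<kappa>')
    have chartV: "is_chart X (V, d)" and "openin X V"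
      using is_chart[OF \<kappa>'] by (auto simp: is_chart_def)
    have compat: "smooth_on (d \<circ> inv_into U c) (c ` (U \<inter> V))" "smooth_on (c \<circ> inv_into V d) (d ` (U \<inter> V))"
      using surface chart \<kappa>' unfolding smooth_surface_def compatible_def by fastforce+
    have WV: "openin X (W \<inter> V)"
      using W_open \<open>openin X V\<close> by (rule openin_Int)
    have WU: "W \<subseteq> U" by (auto simp: W_def)
    have "smooth_on (d \<circ> inv_into W (\<psi> \<circ> c)) ((\<psi> \<circ> c) ` (W \<inter> V))"
    proof (rule smooth_on_cong)
      show op: "open ((\<psi> \<circ> c) ` (W \<inter> V))"
        by (rule open_chart_image[OF chartW WV]) simp
      have sub: "(\<psi> \<circ> c) ` (W \<inter> V) \<subseteq> R"
        using image by blast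
      then show "(d \<circ> inv_into U c) (g y) = (d \<circ> inv_into W (\<psi> \<circ> c)) y" if "y \<in> (\<psi> \<circ> c) ` (W \<inter> V)" for y
        using inv that by auto
      show "smooth_on (\<lambda>y. (d \<circ> inv_into U c) (g y)) ((\<psi> \<circ> c) ` (W \<inter> V))"
      proof (rule smooth_on_compose[OF op smooth_on_subset[OF smooth(2) sub] compat(1)])
        show "g ` (\<psi> \<circ> c) ` (W \<inter> V) \<subseteq> c ` (U \<inter> V)"
          using homf(2) by (auto simp: W_def)
      qed
    qed
    moreover have "smooth_on ((\<psi> \<circ> c) \<circ> inv_into V d) (d ` (W \<inter> V))"
    proof -
      have op: "open (d ` (W \<inter> V))"
        by (rule open_chart_image[OF chartV WV]) simp
      have "smooth_on (\<lambda>y. \<psi> ((c \<circ> inv_into V d) y)) (d ` (W \<inter> V))"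
      proof (rule smooth_on_compose[OF op smooth_on_subset[OF compat(2)] smooth(1)])
        show "d ` (W \<inter> V) \<subseteq> d ` (U \<inter> V)"
          using WU by blast
        show "(c \<circ> inv_into V d) ` d ` (W \<inter> V) \<subseteq> N"
          using inv_into_f_f[OF chart_inj_on[OF chartV]] by (auto simp: W_def)
      qed
      then show ?thesis
        by (simp add: comp_def)
    qed
    ultimately show ?thesis
      by (simp add: compatible_def)
  qed
  then show ?thesis
    using chartW unfolding smooth_chart_def W_def by blast
qed

lemma translation_rigid_motion: "rigid_motion (\<lambda>w. w + b)"
  unfolding rigid_motion_def
  by (intro exI[of _ "mat 1 :: complex^2^2"] exI[of _ b]) simp

theorem theorem7:
  fixes X :: "'a topology" and \<A> :: "'a chart set" and F :: "'a \<Rightarrow> complex^2"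
  assumes "lagrangian_surface X \<A> F"
    and "marginally_trapped \<A> F"
    and "quasi_biharmonic \<A> F"
  shows "\<forall>p\<in>topspace X. \<exists>W \<psi> \<Phi> (\<mu>::real) I z.
           smooth_chart X \<A> (W, \<psi>) \<and> p \<in> W \<and> rigid_motion \<Phi> \<and> \<mu> \<noteq> 0 \<and>
           open I \<and> is_interval I \<and> (\<forall>q\<in>W. \<psi> q $ 1 \<in> I) \<and>
           null_curve z I \<and> z ` I \<subseteq> light_cone \<and>
           (\<forall>x\<in>I. lorentz (z x) (J (velocity z x)) = inverse \<mu>) \<and>
           (\<forall>x\<in>I. acceleration z x \<noteq> 0) \<and>
           (\<forall>q\<in>W. F q = \<Phi> (exp (\<i> * of_real (\<mu> * \<psi> q $ 2)) *s z (\<psi> q $ 1)))"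
proof
  fix p assume "p \<in> topspace X"
  have surface: "smooth_surface X \<A>"
    using assms(1) by (simp add: lagrangian_surface_def)
  then obtain U c where chart: "(U, c) \<in> \<A>" and "p \<in> U"
    using \<open>p \<in> topspace X\<close> unfolding smooth_surface_def by fastforce
  have is_chart: "is_chart X (U, c)"
    using surface chart by (auto simp: smooth_surface_def)
  define f where "f = local_rep F (U, c)"
  define S where "S = chart_image (U, c)"
  have S: "S = c ` U" "open S"
    using is_chart by (auto simp: S_def chart_image_def is_chart_def)
  have f: "f (c q) = F q" if "q \<in> U" for q
    using inv_into_f_f[OF chart_inj_on[OF is_chart] that] by (simp add: f_def local_rep_def)
  have lag: "smooth_on f S" "\<And>u. u \<in> S \<Longrightarrow> inj (differential f u)" "\<And>u. u \<in> S \<Longrightarrow> nondegenerate f u"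
    "\<And>u. u \<in> S \<Longrightarrow> J ` tangent_space f u = normal_space f u"
    using assms(1) chart unfolding lagrangian_surface_def f_def S_def Let_def by blast+
  have mean: "lightlike (mean_curvature f e u)"
    if "open V" "V \<subseteq> S" "orthonormal_frame f V e" "u \<in> V" for V e u
    using assms(2) chart that unfolding marginally_trapped_def f_def S_def by blast
  have bitens: "lightlike (bitension f e u)"
    if "open V" "V \<subseteq> S" "orthonormal_frame f V e" "u \<in> V" for V e u
    using assms(3) chart that unfolding quasi_biharmonic_def f_def S_def by blast
  have "c p \<in> S"
    using S(1) \<open>p \<in> U\<close> by blast
  obtain V X1 X2 where V: "c p \<in> V" "V \<subseteq> S" and frame: "mean_null_frame f V X1 X2"
    and ll: "\<And>u. u \<in> V \<Longrightarrow> lightlike (along X1 (along X2 (along X1 f)) u)"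
    by (rule mean_null_frame_exists[OF S(2) lag mean bitens \<open>c p \<in> S\<close>];
        (assumption | (rule that, assumption+)))
  obtain \<psi> g :: "real^2 \<Rightarrow> real^2" and N R I z b where N: "open N" "c p \<in> N" "N \<subseteq> V"
    and R: "open R" and hom: "homeomorphism N R \<psi> g" and sm: "smooth_on \<psi> N" "smooth_on g R"
    and I: "open I" "is_interval I" "\<And>u. u \<in> N \<Longrightarrow> \<psi> u $ 1 \<in> I"
    and z: "null_curve z I" "z ` I \<subseteq> light_cone" "\<And>x. x \<in> I \<Longrightarrow> lorentz (z x) (J (velocity z x)) = 1"
      "\<And>x. x \<in> I \<Longrightarrow> acceleration z x \<noteq> 0"
    and form: "\<And>u. u \<in> N \<Longrightarrow> f u = exp (\<i> * of_real (\<psi> u $ 2)) *s z (\<psi> u $ 1) + b"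
    by (rule mean_null_frame.local_normal_form[OF frame ll V(1)]; (assumption | (rule that, assumption+)))
  define W where "W = {q \<in> U. c q \<in> N}"
  have "smooth_chart X \<A> (W, \<psi> \<circ> c)"
    unfolding W_def
    by (rule smooth_chart_change_coordinates[OF surface chart N(1) _ R hom sm]) (use N(3) V(2) S(1) in blast)
  moreover have "p \<in> W"
    using \<open>p \<in> U\<close> N(2) by (simp add: W_def)
  moreover have "F q = exp (\<i> * of_real (1 * (\<psi> \<circ> c) q $ 2)) *s z ((\<psi> \<circ> c) q $ 1) + b" if "q \<in> W" for q
    using form[of "c q"] f[of q] that by (simp add: W_def)
  ultimately show "\<exists>W \<psi> \<Phi> (\<mu>::real) I z.
           smooth_chart X \<A> (W, \<psi>) \<and> p \<in> W \<and> rigid_motion \<Phi> \<and> \<mu> \<noteq> 0 \<and>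
           open I \<and> is_interval I \<and> (\<forall>q\<in>W. \<psi> q $ 1 \<in> I) \<and>
           null_curve z I \<and> z ` I \<subseteq> light_cone \<and>
           (\<forall>x\<in>I. lorentz (z x) (J (velocity z x)) = inverse \<mu>) \<and>
           (\<forall>x\<in>I. acceleration z x \<noteq> 0) \<and>
           (\<forall>q\<in>W. F q = \<Phi> (exp (\<i> * of_real (\<mu> * \<psi> q $ 2)) *s z (\<psi> q $ 1)))"
    using translation_rigid_motion[of b] I z
    by (intro exI[of _ W] exI[of _ "\<psi> \<circ> c"] exI[of _ "\<lambda>w. w + b"] exI[of _ 1] exI[of _ I] exI[of _ z])
      (auto simp: W_def)
qed

end
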